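(* For each of the problems LoadCVRP, GasCVRP, and LoadGasCVRP, there is an algorithm that computes an optimal routing in $|C|^{O(|C|)}\cdot n^{O(1)}$ steps, where $C$ is the set of clients and $n=|V(G)|$ is the number of vertices of the input graph.
   Context: All graphs are finite and undirected, and $\mathbb N = \{0,1,2,\dots\}$, $\mathbb N^+=\{1,2,\dots\}$. A walk in $G$ is a sequence of vertices $(v_1,\dots,v_m)$ with consecutive vertices adjacent; vertices and edges may be repeated. It is closed if $v_1 = v_m$. The weight of a walk is $w(p)=\sum_{i=1}^{m-1} w(v_i,v_{i+1})$. Common setting: an instance contains a graph $G$ with edge weights $w\colon E(G)\to\mathbb N$, a nonempty set of depots $D\subseteq V(G)$, a set of clients $C\subseteq V(G)$, and a number of vehicles $k\in\mathbb N$. A routing is a set of $k'$ walks $R=\{p_1,\dots,p_{k'}\}$ (one walk per vehicle) together with an assignment $A\colon C\to[k']$ such that $k'\le k$, every walk starts at a vertex of $D$, every client $c\in C$ is a vertex of $p_{A(c)}$, every walk in $R$ is closed, and the additional constraints below hold. Its weight is $w(R)=\sum_{p\in R}w(p)$; a routing of minimum weight is called optimal. LoadCVRP (Load-Capacitated Vehicle Routing Problem): the instance additionally contains a load capacity $\ell\in\mathbb N$ and demands $\Lambda\colon C\to\mathbb N^+$; the additional constraint is $\sum_{c\in A^{-1}(i)}\Lambda(c)\le\ell$ for every $i\in[k']$. GasCVRP (Gas-Capacitated Vehicle Routing Problem): the instance additionally contains a gas capacity $g\in\mathbb N$; the additional constraint is $w(p)\le g$ for every $p\in R$. LoadGasCVRP: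 the instance additionally contains $\ell$, $\Lambda$ and $g$, and both constraints are imposed. *)

theory Defs
  imports Main
begin

section \<open>Vehicle routing\<close>

text \<open>Graphs are simple and undirected: an edge is a two-element set of vertices.
  A problem without a load (gas) constraint has \<open>None\<close> in the corresponding field;
  \<open>load\<close> holds the capacity together with the demands.\<close>

record 'v cvrp =
  verts :: "'v set"
  edges :: "'v set set"
  weight :: "'v set \<Rightarrow> nat"
  depots :: "'v set"
  clients :: "'v set"
  vehicles :: nat
  load :: "(nat \<times> ('v \<Rightarrow> nat)) option"
  gas :: "nat option"

definition cvrp_instance :: "'v cvrp \<Rightarrow> bool" where
  "cvrp_instance I \<longleftrightarrow>
     finite (verts I) \<and>
     (\<forall>e \<in> edges I. e \<subseteq> verts I \<and> card e = 2) \<and>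
     depots I \<subseteq> verts I \<and> depots I \<noteq> {} \<and>
     clients I \<subseteq> verts I \<and>
     (\<forall>l dem. load I = Some (l, dem) \<longrightarrow> (\<forall>c \<in> clients I. dem c > 0))"

definition LoadCVRP :: "'v cvrp set" where
  "LoadCVRP = {I. cvrp_instance I \<and> load I \<noteq> None \<and> gas I = None}"

definition GasCVRP :: "'v cvrp set" where
  "GasCVRP = {I. cvrp_instance I \<and> load I = None \<and> gas I \<noteq> None}"

definition LoadGasCVRP :: "'v cvrp set" where
  "LoadGasCVRP = {I. cvrp_instance I \<and> load I \<noteq> None \<and> gas I \<noteq> None}"

definition walk :: "'v cvrp \<Rightarrow> 'v list \<Rightarrow> bool" where
  "walk I p \<longleftrightarrow> p \<noteq> [] \<and> set p \<subseteq> verts I \<and> successively (\<lambda>u v. {u, v} \<in> edges I) p"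

definition walk_weight :: "'v cvrp \<Rightarrow> 'v list \<Rightarrow> nat" where
  "walk_weight I p = (\<Sum>i < length p - 1. weight I {p ! i, p ! Suc i})"

text \<open>The walks form a list, one walk per vehicle, so that a walk driven by two vehicles
  counts twice. Vehicles are numbered from 0, and only the values of \<open>A\<close> on clients matter.\<close>

definition routing :: "'v cvrp \<Rightarrow> 'v list list \<Rightarrow> ('v \<Rightarrow> nat) \<Rightarrow> bool" where
  "routing I R A \<longleftrightarrow>
     length R \<le> vehicles I \<and>
     (\<forall>p \<in> set R. walk I p \<and> hd p \<in> depots I \<and> hd p = last p) \<and>
     (\<forall>c \<in> clients I. A c < length R \<and> c \<in> set (R ! A c)) \<and>
     (\<forall>l dem. load I = Some (l, dem) \<longrightarrow>
        (\<forall>i < length R. (\<Sum>c | c \<in> clients I \<and> A c = i. dem c) \<le> l)) \<and>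
     (\<forall>g. gas I = Some g \<longrightarrow> (\<forall>p \<in> set R. walk_weight I p \<le> g))"

definition routing_weight :: "'v cvrp \<Rightarrow> 'v list list \<Rightarrow> nat" where
  "routing_weight I R = (\<Sum>p \<leftarrow> R. walk_weight I p)"

definition optimal_routing :: "'v cvrp \<Rightarrow> 'v list list \<Rightarrow> ('v \<Rightarrow> nat) \<Rightarrow> bool" where
  "optimal_routing I R A \<longleftrightarrow>
     routing I R A \<and> (\<forall>R' A'. routing I R' A' \<longrightarrow> routing_weight I R \<le> routing_weight I R')"

section \<open>Random access machine programs\<close>

text \<open>Structured programs for a random access machine under the uniform cost measure.
  Memory is divided into arrays of natural numbers: \<open>m a i\<close> is the content of cell \<open>i\<close> of
  array \<open>a\<close>. Array names are constants in a program, so a program uses finitely many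
  arrays and these can be interleaved in a single address space; indices are computed, which
  gives indirect addressing. Arithmetic consists of addition and truncated subtraction only:
  with multiplication at unit cost the model would be unreasonably strong, whereas here
  numbers grow by a constant number of bits per step.\<close>

type_synonym mem = "nat \<Rightarrow> nat \<Rightarrow> nat"

datatype expr =
    Const nat
  | Cell nat expr
  | Plus expr expr
  | Minus expr expr

datatype cond =
    Less expr expr
  | Equal expr expr
  | Neg cond
  | Conj cond cond

datatype prog =
    Skip
  | Assign nat expr expr
  | Seq prog prog
  | If cond prog prog
  | While cond prog

primrec expr_val :: "mem \<Rightarrow> expr \<Rightarrow> nat" where
  "expr_val m (Const k) = k"
| "expr_val m (Cell a e) = m a (expr_val m e)"
| "expr_val m (Plus e f) = expr_val m e + expr_val m f"
| "expr_val m (Minus e f) = expr_val m e - expr_val m f"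

primrec cond_val :: "mem \<Rightarrow> cond \<Rightarrow> bool" where
  "cond_val m (Less e f) \<longleftrightarrow> expr_val m e < expr_val m f"
| "cond_val m (Equal e f) \<longleftrightarrow> expr_val m e = expr_val m f"
| "cond_val m (Neg b) \<longleftrightarrow> \<not> cond_val m b"
| "cond_val m (Conj b c) \<longleftrightarrow> cond_val m b \<and> cond_val m c"

text \<open>\<open>exec p m t m'\<close>: started in \<open>m\<close>, program \<open>p\<close> halts in \<open>m'\<close> after \<open>t\<close> steps. An assignment
  or a test counts as one step; the expressions in it have a size fixed by the program, so
  this differs from counting single operations by a constant factor.\<close>

inductive exec :: "prog \<Rightarrow> mem \<Rightarrow> nat \<Rightarrow> mem \<Rightarrow> bool" where
  exec_Skip: "exec Skip m 1 m"
| exec_Assign: "exec (Assign a i e) m 1 (m(a := (m a)(expr_val m i := expr_val m e)))"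
| exec_Seq: "exec p m s m' \<Longrightarrow> exec q m' t m'' \<Longrightarrow> exec (Seq p q) m (s + t) m''"
| exec_IfTrue: "cond_val m b \<Longrightarrow> exec p m t m' \<Longrightarrow> exec (If b p q) m (t + 1) m'"
| exec_IfFalse: "\<not> cond_val m b \<Longrightarrow> exec q m t m' \<Longrightarrow> exec (If b p q) m (t + 1) m'"
| exec_WhileFalse: "\<not> cond_val m b \<Longrightarrow> exec (While b p) m 1 m"
| exec_WhileTrue: "cond_val m b \<Longrightarrow> exec p m s m' \<Longrightarrow> exec (While b p) m' t m'' \<Longrightarrow>
    exec (While b p) m (s + t + 1) m''"

lemma exec_deterministic:
  "exec p m t m' \<Longrightarrow> exec p m s m'' \<Longrightarrow> s = t \<and> m'' = m'"
proof (induction arbitrary: s m'' rule: exec.induct)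
  case (exec_Seq p m s m' q t m'')
  from exec_Seq.prems show ?case by cases (use exec_Seq.IH in blast)
next
  case (exec_WhileTrue m b p s m' t m'')
  from exec_WhileTrue.prems show ?case
    by cases (use exec_WhileTrue.IH exec_WhileTrue.hyps in blast)+
qed (erule exec.cases; blast)+

section \<open>Solving routing problems by programs\<close>

text \<open>The vertices of an input graph are numbered \<open>0, \<dots>, n - 1\<close>. Array 0 holds the numeric
  parameters, arrays 1 and 2 the characteristic functions of the depots and of the clients,
  array 3 the demands, and arrays 4 and 5 the adjacency matrix and the weight matrix, both
  stored row by row. Weights may be 0, so the weight matrix does not determine the graph.\<close>

definition input_mem :: "nat cvrp \<Rightarrow> mem" where
  "input_mem I =
    (let n = card (verts I) in
     (\<lambda>a i.
       if a = 0 then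
         (if i = 0 then n
          else if i = 1 then vehicles I
          else if i = 2 then (case load I of Some (l, dem) \<Rightarrow> l | None \<Rightarrow> 0)
          else if i = 3 then (case gas I of Some g \<Rightarrow> g | None \<Rightarrow> 0)
          else 0)
       else if a = 1 then of_bool (i \<in> depots I)
       else if a = 2 then of_bool (i \<in> clients I)
       else if a = 3 then
         (case load I of Some (l, dem) \<Rightarrow> if i \<in> clients I then dem i else 0 | None \<Rightarrow> 0)
       else if a = 4 then of_bool ({i div n, i mod n} \<in> edges I)
       else if a = 5 then
         (if {i div n, i mod n} \<in> edges I then weight I {i div n, i mod n} else 0)
       else 0))"

text \<open>The output is in arrays 6 to 9. Cell 0 of array 6 tells whether there is a routing;
  if so, cell 1 is the number of walks, array 7 contains their numbers of vertices, array 8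
  the walks one after another, and array 9 the assignment.\<close>

definition outputs_routing :: "nat cvrp \<Rightarrow> mem \<Rightarrow> nat list list \<Rightarrow> (nat \<Rightarrow> nat) \<Rightarrow> bool" where
  "outputs_routing I m R A \<longleftrightarrow>
     m 6 0 = 1 \<and> m 6 1 = length R \<and>
     map (m 7) [0..<length R] = map length R \<and>
     map (m 8) [0..<length (concat R)] = concat R \<and>
     (\<forall>c \<in> clients I. m 9 c = A c)"

definition outputs_none :: "mem \<Rightarrow> bool" where
  "outputs_none m \<longleftrightarrow> m 6 0 = 0"

text \<open>The bound \<open>T\<close> takes the number of clients and the number of vertices.\<close>

definition solves_within :: "prog \<Rightarrow> nat cvrp set \<Rightarrow> (nat \<Rightarrow> nat \<Rightarrow> nat) \<Rightarrow> bool" where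
  "solves_within p P T \<longleftrightarrow>
     (\<forall>I \<in> P. verts I = {..<card (verts I)} \<longrightarrow>
       (\<exists>t m. exec p (input_mem I) t m \<and>
              t \<le> T (card (clients I)) (card (verts I)) \<and>
              (if \<exists>R A. routing I R A
               then \<exists>R A. outputs_routing I m R A \<and> optimal_routing I R A
               else outputs_none m)))"

end

(*
  Only the tours matter that visit an ordered list of clients along shortest paths, starting and
  ending at the depot that is best for the first and the last client. A routing yields such tours
  of no larger cost by listing the clients assigned to a vehicle in the order of their appearance
  on its walk. A partition of the c clients into ordered lists is a word of length c over 2 c
  letters (a client, and whether it is the last one of its tour), so (2 c) ^ c words are tried.

  The machine cannot multiply or divide, hence words are numbers whose digits are read off from
  tables of quotients and remainders; these take time (2 c) ^ c as well. Shortest walks with at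
  most k edges are computed for k = 0, ..., n, which lets a walk be recovered from the choices of
  the next vertex even if there are edges of weight 0.
*)

theory Submission
  imports Defs "HOL-Library.Sublist"
begin

section \<open>Running times of programs\<close>

text \<open>Infinity has to be an ordinary number that the machine can compute. \<open>big\<close>
  exceeds the cost of every plan that stems from a routing, while a missing edge or a base that is
  not a depot adds at least \<open>big\<close>. A total below \<open>big\<close> therefore certifies
  at once that all walks exist and start at depots; if no word scores below \<open>big\<close>,
  there is no routing at all.

  Passing from a routing to tours preserves every constraint: the clients of a vehicle stay the
  same, hence so does its load; its cost does not grow, so the gas limit still holds; and dropping
  vehicles without clients only lowers their number.

  The tours of a plan list each client exactly once, which is why a word has exactly c letters and
  why a count of distinct letters suffices to recognise a plan. The factor 2 in the number of
  letters is absorbed by \<open>c + c \<le> c ^ 2\<close> for c \<ge> 2, so the bound takes the form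
  \<open>c ^ (2 * c)\<close>. The three problems share one program up to a flag for the gas
  limit.\<close>

definition run :: "prog \<Rightarrow> mem \<Rightarrow> nat \<Rightarrow> (mem \<Rightarrow> bool) \<Rightarrow> bool" where
  "run p m T Q \<longleftrightarrow> (\<exists>t m'. exec p m t m' \<and> t \<le> T \<and> Q m')"

text \<open>Frame information at the granularity of arrays. Scalars occupy cell 0 of arrays of their
  own, so an array outside this set is known to be unchanged as a whole and no reasoning about
  single cells is required.\<close>

primrec writes :: "prog \<Rightarrow> nat set" where
  "writes Skip = {}"
| "writes (Assign a i e) = {a}"
| "writes (Seq p q) = writes p \<union> writes q"
| "writes (If b p q) = writes p \<union> writes q"
| "writes (While b p) = writes p"

primrec reads :: "expr \<Rightarrow> nat set" where
  "reads (Const k) = {}"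
| "reads (Cell a e) = insert a (reads e)"
| "reads (Plus e f) = reads e \<union> reads f"
| "reads (Minus e f) = reads e \<union> reads f"

abbreviation Var :: "nat \<Rightarrow> expr" where
  "Var a \<equiv> Cell a (Const 0)"

abbreviation Set_Var :: "nat \<Rightarrow> expr \<Rightarrow> prog" (infix "::=" 65) where
  "a ::= e \<equiv> Assign a (Const 0) e"

abbreviation Seq_infix :: "prog \<Rightarrow> prog \<Rightarrow> prog" (infixr ";;" 60) where
  "p ;; q \<equiv> Seq p q"

text \<open>The bound \<open>e\<close> is evaluated again at every test; this is why the loop rule
  demands that counter and body leave the arrays read by \<open>e\<close> alone.\<close>

definition For :: "nat \<Rightarrow> expr \<Rightarrow> prog \<Rightarrow> prog" where
  "For x e p = x ::= Const 0 ;; While (Less (Var x) e) (p ;; x ::= Plus (Var x) (Const 1))"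

lemma writes_For [simp]: "writes (For x e p) = insert x (writes p)"
  by (auto simp: For_def)

lemma expr_val_cong: "(\<And>a. a \<in> reads e \<Longrightarrow> m a = m' a) \<Longrightarrow> expr_val m e = expr_val m' e"
  by (induction e) auto

lemma exec_writes: "exec p m t m' \<Longrightarrow> a \<notin> writes p \<Longrightarrow> m' a = m a"
  by (induction rule: exec.induct) auto

lemma exec_Skip_iff: "exec Skip m t m' \<longleftrightarrow> t = 1 \<and> m' = m"
  by (metis exec_Skip exec_deterministic)

lemma exec_Assign_iff:
  "exec (Assign a i e) m t m' \<longleftrightarrow> t = 1 \<and> m' = m(a := (m a)(expr_val m i := expr_val m e))"
  by (metis exec_Assign exec_deterministic)

inductive_cases exec_SeqE: "exec (p ;; q) m t m'"
inductive_cases exec_IfE: "exec (If b p q) m t m'"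

lemma exec_Seq_iff:
  "exec (p ;; q) m t m'' \<longleftrightarrow> (\<exists>s r m'. exec p m s m' \<and> exec q m' r m'' \<and> t = s + r)"
  by (blast elim: exec_SeqE intro: exec_Seq)

lemma exec_If_iff:
  "exec (If b p q) m t m' \<longleftrightarrow> (\<exists>s. t = s + 1 \<and> exec (if cond_val m b then p else q) m s m')"
proof
  show "exec (If b p q) m t m' \<Longrightarrow> \<exists>s. t = s + 1 \<and> exec (if cond_val m b then p else q) m s m'"
    by (erule exec_IfE) auto
  show "\<exists>s. t = s + 1 \<and> exec (if cond_val m b then p else q) m s m' \<Longrightarrow> exec (If b p q) m t m'"
    using exec_IfTrue[of m b p] exec_IfFalse[of m b q] by (auto split: if_splits)
qed

section \<open>Symbolic execution of programs and rules for loops\<close>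

lemma run_Skip [simp]: "run Skip m T Q \<longleftrightarrow> 1 \<le> T \<and> Q m"
  by (auto simp: run_def exec_Skip_iff)

lemma run_Assign [simp]:
  "run (Assign a i e) m T Q \<longleftrightarrow> 1 \<le> T \<and> Q (m(a := (m a)(expr_val m i := expr_val m e)))"
  by (auto simp: run_def exec_Assign_iff)

lemma run_If [simp]:
  "run (If b p q) m T Q \<longleftrightarrow> 1 \<le> T \<and> (if cond_val m b then run p m (T - 1) Q else run q m (T - 1) Q)"
  by (cases T) (auto simp: run_def exec_If_iff)

text \<open>Besides the intermediate assertion, the continuation may use that \<open>p\<close>
  changed only the arrays it writes, so assertions need not carry the rest of the memory
  along.\<close>

lemma run_Seq:
  "run p m S R \<Longrightarrow> (\<And>m'. R m' \<Longrightarrow> (\<And>a. a \<notin> writes p \<Longrightarrow> m' a = m a) \<Longrightarrow> run q m' T' Q) \<Longrightarrow>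
    S + T' \<le> T \<Longrightarrow> run (p ;; q) m T Q"
  unfolding run_def by (meson add_mono exec_Seq exec_writes le_trans)

lemma run_weaken:
  "run p m S R \<Longrightarrow> S \<le> T \<Longrightarrow> (\<And>m'. R m' \<Longrightarrow> (\<And>a. a \<notin> writes p \<Longrightarrow> m' a = m a) \<Longrightarrow> Q m') \<Longrightarrow> run p m T Q"
  unfolding run_def by (meson exec_writes le_trans)

lemma run_Seq_Skip [simp]: "run (Skip ;; q) m T Q \<longleftrightarrow> 1 \<le> T \<and> run q m (T - 1) Q"
  by (cases T) (auto simp: run_def exec_Seq_iff exec_Skip_iff)

lemma run_Seq_Assign [simp]:
  "run (Assign a i e ;; q) m T Q \<longleftrightarrow>
    1 \<le> T \<and> run q (m(a := (m a)(expr_val m i := expr_val m e))) (T - 1) Q"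
  by (cases T) (auto simp: run_def exec_Seq_iff exec_Assign_iff)

lemma run_Seq_Seq [simp]: "run ((p ;; q) ;; r) m T Q \<longleftrightarrow> run (p ;; q ;; r) m T Q"
proof -
  have "exec ((p ;; q) ;; r) m t m' \<longleftrightarrow> exec (p ;; q ;; r) m t m'" for t m'
    unfolding exec_Seq_iff by (metis add.assoc)
  then show ?thesis unfolding run_def by simp
qed

text \<open>Moving the continuation into both branches leaves no composite program in front;
  together with the preceding rules the simplifier then executes loop-free code. Budgets being upper
  bounds, the branches may take different times.\<close>

lemma run_Seq_If [simp]:
  "run (If b p q ;; r) m T Q \<longleftrightarrow>
    1 \<le> T \<and> (if cond_val m b then run (p ;; r) m (T - 1) Q else run (q ;; r) m (T - 1) Q)"
proof -
  have "exec (If b p q ;; r) m t m' \<longleftrightarrow> exec (If b (p ;; r) (q ;; r)) m t m'" for t m'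
  proof
    assume "exec (If b p q ;; r) m t m'"
    then obtain s u m1 where "t = s + u + 1" "exec (if cond_val m b then p else q) m s m1" "exec r m1 u m'"
      unfolding exec_Seq_iff exec_If_iff by auto
    then show "exec (If b (p ;; r) (q ;; r)) m t m'"
      unfolding exec_If_iff by (intro exI[of _ "s + u"]) (auto intro: exec_Seq)
  next
    assume "exec (If b (p ;; r) (q ;; r)) m t m'"
    then obtain s u m1 where "t = s + u + 1" "exec (if cond_val m b then p else q) m s m1" "exec r m1 u m'"
      unfolding exec_If_iff by (auto simp: exec_Seq_iff split: if_splits)
    then show "exec (If b p q ;; r) m t m'"
      unfolding exec_Seq_iff[of "If b p q"] exec_If_iff
      by (intro exI[of _ "s + 1"] exI[of _ u] exI[of _ m1]) simp
  qed
  then have "run (If b p q ;; r) m T Q \<longleftrightarrow> run (If b (p ;; r) (q ;; r)) m T Q"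
    unfolding run_def by simp
  then show ?thesis by simp
qed

text \<open>Induction on the number of remaining iterations, where \<open>J\<close> is indexed by
  the completed ones. Each iteration pays one step for its test, and the failing test pays the last
  one.\<close>

lemma run_While:
  assumes init: "J 0 m"
    and step: "\<And>i m'. i < N \<Longrightarrow> J i m' \<Longrightarrow> (\<And>a. a \<notin> writes p \<Longrightarrow> m' a = m a) \<Longrightarrow>
      cond_val m' b \<and> run p m' T (J (Suc i))"
    and stop: "\<And>m'. J N m' \<Longrightarrow> (\<And>a. a \<notin> writes p \<Longrightarrow> m' a = m a) \<Longrightarrow> \<not> cond_val m' b \<and> Q m'"
    and time: "N * (T + 1) + 1 \<le> T'"
  shows "run (While b p) m T' Q"
proof -
  have "run (While b p) m' (k * (T + 1) + 1) Q"
    if "k \<le> N" "J (N - k) m'" "\<And>a. a \<notin> writes p \<Longrightarrow> m' a = m a" for k m'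
    using that
  proof (induction k arbitrary: m')
    case 0
    then have "\<not> cond_val m' b" "Q m'" using stop[of m'] by auto
    then show ?case using exec_WhileFalse[of m' b p] unfolding run_def
      by (intro exI[of _ 1] exI[of _ m']) simp
  next
    case (Suc k)
    from step[of "N - Suc k" m'] Suc.prems obtain s m1
      where *: "cond_val m' b" "exec p m' s m1" "s \<le> T" "J (N - k) m1"
      unfolding run_def by (simp add: Suc_diff_Suc Suc_le_lessD) blast
    have "run (While b p) m1 (k * (T + 1) + 1) Q"
    proof (rule Suc.IH)
      show "m1 a = m a" if "a \<notin> writes p" for a
        using exec_writes[OF *(2) that] Suc.prems(3)[OF that] by simp
    qed (use Suc.prems(1) *(4) in auto)
    then obtain t m2 where "exec (While b p) m1 t m2" "t \<le> k * (T + 1) + 1" "Q m2"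
      unfolding run_def by blast
    then show ?case using exec_WhileTrue[OF *(1,2)] *(3) unfolding run_def
      by (intro exI[of _ "s + t + 1"] exI[of _ m2]) auto
  qed
  from this[of N m] init have "run (While b p) m (N * (T + 1) + 1) Q" by simp
  then show ?thesis using time by (rule run_weaken)
qed

text \<open>The step premise looks at the memory after the increment, since the invariant for
  \<open>Suc i\<close> is claimed with the counter already raised. Test and increment cost 2 steps
  per iteration, initialisation and failing test 2 more.\<close>

lemma run_For:
  assumes N: "expr_val m e = N"
    and indep: "x \<notin> writes p" "reads e \<inter> insert x (writes p) = {}"
    and init: "J 0 (m(x := (m x)(0 := 0)))"
    and step: "\<And>i m'. i < N \<Longrightarrow> J i m' \<Longrightarrow> m' x 0 = i \<Longrightarrow>
      (\<And>a. a \<notin> insert x (writes p) \<Longrightarrow> m' a = m a) \<Longrightarrow>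
      run p m' T (\<lambda>m''. J (Suc i) (m''(x := (m'' x)(0 := Suc i))))"
    and stop: "\<And>m'. J N m' \<Longrightarrow> (\<And>a. a \<notin> insert x (writes p) \<Longrightarrow> m' a = m a) \<Longrightarrow> Q m'"
    and time: "N * (T + 2) + 2 \<le> T'"
  shows "run (For x e p) m T' Q"
proof -
  let ?m = "m(x := (m x)(0 := 0))"
  have e: "expr_val m' e = N" if "\<And>a. a \<notin> insert x (writes p) \<Longrightarrow> m' a = m a" for m'
    using expr_val_cong[of e m' m] that indep N by (metis disjoint_iff)
  have "run (While (Less (Var x) e) (p ;; x ::= Plus (Var x) (Const 1))) ?m (N * (T + 2) + 1) Q"
  proof (rule run_While[where N = N and T = "T + 1" and J = "\<lambda>i m'. m' x 0 = i \<and> J i m'"])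
    show "?m x 0 = 0 \<and> J 0 ?m" using init by simp
  next
    fix i m' assume *: "i < N" "m' x 0 = i \<and> J i m'"
      "\<And>a. a \<notin> writes (p ;; x ::= Plus (Var x) (Const 1)) \<Longrightarrow> m' a = ?m a"
    have f: "m' a = m a" if "a \<notin> insert x (writes p)" for a using *(3)[of a] that by simp
    have "run (p ;; x ::= Plus (Var x) (Const 1)) m' (T + 1) (\<lambda>m'. m' x 0 = Suc i \<and> J (Suc i) m')"
      by (rule run_Seq[OF step[of i m']]) (use * f indep in auto)
    then show "cond_val m' (Less (Var x) e) \<and>
      run (p ;; x ::= Plus (Var x) (Const 1)) m' (T + 1) (\<lambda>m'. m' x 0 = Suc i \<and> J (Suc i) m')"
      using * e[OF f] by simp
  next
    fix m' assume *: "m' x 0 = N \<and> J N m'"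
      "\<And>a. a \<notin> writes (p ;; x ::= Plus (Var x) (Const 1)) \<Longrightarrow> m' a = ?m a"
    have f: "m' a = m a" if "a \<notin> insert x (writes p)" for a using *(2)[of a] that by simp
    show "\<not> cond_val m' (Less (Var x) e) \<and> Q m'" using * e[OF f] stop[OF _ f] by simp
  qed auto
  then show ?thesis using time unfolding For_def run_Seq_Assign
    by (intro conjI) (auto elim!: run_weaken)
qed

section \<open>Walks and tours\<close>

lemma walk_weight_single [simp]: "walk_weight I [v] = 0"
  by (simp add: walk_weight_def)

lemma walk_weight_Cons [simp]: "walk_weight I (u # v # p) = weight I {u, v} + walk_weight I (v # p)"
  by (simp add: walk_weight_def sum.lessThan_Suc_shift del: sum.lessThan_Suc)

lemma walk_weight_append: "walk_weight I (p @ v # q) = walk_weight I (p @ [v]) + walk_weight I (v # q)"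
proof (induction p)
  case (Cons x p)
  then show ?case by (cases p) simp_all
qed simp

lemma walk_single [simp]: "walk I [v] \<longleftrightarrow> v \<in> verts I"
  by (simp add: walk_def)

lemma walk_Cons [simp]:
  "walk I (u # v # p) \<longleftrightarrow> u \<in> verts I \<and> {u, v} \<in> edges I \<and> walk I (v # p)"
  by (auto simp: walk_def)

lemma walk_append: "walk I (p @ v # q) \<longleftrightarrow> walk I (p @ [v]) \<and> walk I (v # q)"
proof (induction p)
  case Nil
  then show ?case by (cases q) auto
next
  case (Cons x p)
  then show ?case by (cases p) simp_all
qed

text \<open>Cutting out the closed piece between two occurrences of a vertex cannot raise the
  weight, as weights are natural numbers. Hence walks with at most as many vertices as the graph
  suffice.\<close>

lemma walk_distinct:
  assumes "walk I p"
  shows "\<exists>q. walk I q \<and> hd q = hd p \<and> last q = last p \<and> distinct q \<and>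
    walk_weight I q \<le> walk_weight I p"
  using assms
proof (induction "length p" arbitrary: p rule: less_induct)
  case less
  show ?case
  proof (cases "distinct p")
    case False
    then obtain xs ys zs y where p: "p = xs @ [y] @ ys @ [y] @ zs"
      using not_distinct_decomp by blast
    let ?q = "xs @ y # zs"
    have w: "walk_weight I ?q \<le> walk_weight I p"
      using walk_weight_append[of I xs y zs] walk_weight_append[of I xs y "ys @ y # zs"]
        walk_weight_append[of I "y # ys" y zs] unfolding p by simp
    have "walk I ?q"
      using less.prems walk_append[of I xs y zs] walk_append[of I xs y "ys @ y # zs"]
        walk_append[of I "y # ys" y zs] unfolding p by simp
    then obtain q where "walk I q" "hd q = hd ?q" "last q = last ?q" "distinct q"
      "walk_weight I q \<le> walk_weight I ?q"
      using less.hyps[of ?q] unfolding p by auto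
    moreover have "hd ?q = hd p" "last ?q = last p" unfolding p by (cases xs; simp)+
    ultimately show ?thesis using w by (intro exI[of _ q]) simp
  qed (use less.prems in blast)
qed

lemma walk_weight_le:
  assumes "\<And>e. e \<in> edges I \<Longrightarrow> weight I e \<le> S" "walk I p"
  shows "walk_weight I p \<le> (length p - 1) * S"
  using assms(2)
proof (induction p)
  case (Cons u p)
  then show ?case
  proof (cases p)
    case (Cons v q)
    with Cons.IH Cons.prems assms(1)[of "{u, v}"] show ?thesis by simp
  qed simp
qed (simp add: walk_def)

text \<open>A recursion rather than a choice of a minimiser, so that its intermediate values are the
  invariant of the loop in \<open>Argmin\<close>. Ties go to the smallest index.\<close>

primrec argmin :: "(nat \<Rightarrow> nat) \<Rightarrow> nat \<Rightarrow> nat" where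
  "argmin f 0 = 0"
| "argmin f (Suc n) = (if f n < f (argmin f n) then n else argmin f n)"

lemma argmin_le: "i < n \<Longrightarrow> f (argmin f n) \<le> f i"
  by (induction n) (auto simp: less_Suc_eq dest: less_imp_le order_trans)

lemma argmin_less: "0 < n \<Longrightarrow> argmin f n < n"
proof (induction n)
  case (Suc n)
  then show ?case by (cases n) auto
qed simp

text \<open>Filtering and keeping one occurrence of each element respects the order along
  \<open>p\<close>; this order is what lets the legs of a tour be compared with pieces of a
  walk.\<close>

lemma ex_subseq_set:
  assumes "X \<subseteq> set p"
  shows "\<exists>s. subseq s p \<and> distinct s \<and> set s = X"
proof -
  have "subseq (remdups xs) xs" for xs :: "'a list" by (induction xs) auto
  then have "subseq (remdups (filter (\<lambda>x. x \<in> X) p)) p"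
    using subseq_filter_left subseq_order.trans by blast
  then show ?thesis using assms by (intro exI[of _ "remdups (filter (\<lambda>x. x \<in> X) p)"]) auto
qed

section \<open>Costs, distances and plans of an instance\<close>

locale vrp =
  fixes I :: "nat cvrp"
  assumes inst: "cvrp_instance I" and verts: "verts I = {..<card (verts I)}"
begin

definition nv :: nat where "nv = card (verts I)"

definition clist :: "nat list" where "clist = filter (\<lambda>v. v \<in> clients I) [0..<nv]"

text \<open>A bound on every single weight that the machine obtains by additions alone.\<close>

definition wsum :: nat where "wsum = (\<Sum>i<nv * nv. input_mem I 5 i)"

text \<open>Stands for infinity: missing edges and depots cost more than any plan obtained from a routing.\<close>

definition big :: nat where "big = 1 + nv * nv * (wsum + wsum)"

text \<open>Staying at a vertex is a free step, so \<open>dist k\<close> also accounts for walks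
  with fewer than \<open>k\<close> edges.\<close>

definition cost :: "nat \<Rightarrow> nat \<Rightarrow> nat" where
  "cost u v = (if u = v then 0 else if {u, v} \<in> edges I then weight I {u, v} else big)"

text \<open>Bellman-Ford with a fixed target. The recursion splits off the first step, so the
  minimiser is the next vertex and a walk can be read off from its start.\<close>

primrec dist :: "nat \<Rightarrow> nat \<Rightarrow> nat \<Rightarrow> nat" where
  "dist 0 u v = (if u = v then 0 else big)"
| "dist (Suc k) u v = (let f = \<lambda>w. cost u w + dist k w v in f (argmin f nv))"

definition hop :: "nat \<Rightarrow> nat \<Rightarrow> nat \<Rightarrow> nat" where
  "hop k u v = argmin (\<lambda>w. cost u w + dist k w v) nv"

text \<open>The start vertex is left out and free steps contribute nothing, so that consecutive legs
  can simply be appended.\<close>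

primrec path :: "nat \<Rightarrow> nat \<Rightarrow> nat \<Rightarrow> nat list" where
  "path 0 u v = []"
| "path (Suc k) u v = (if hop k u v = u then [] else [hop k u v]) @ path k (hop k u v) v"

fun stops_cost :: "nat list \<Rightarrow> nat" where
  "stops_cost (u # v # s) = dist nv u v + stops_cost (v # s)"
| "stops_cost _ = 0"

fun route :: "nat \<Rightarrow> nat list \<Rightarrow> nat list" where
  "route u [] = []"
| "route u (v # s) = path nv u v @ route v s"

text \<open>Turns the restriction to depots into a cost; the best depot becomes a plain minimum over
  all vertices.\<close>

definition penalty :: "nat \<Rightarrow> nat" where
  "penalty d = (if d \<in> depots I then 0 else big)"

definition depot :: "nat \<Rightarrow> nat \<Rightarrow> nat" where
  "depot u v = argmin (\<lambda>d. dist nv d u + dist nv v d + penalty d) nv"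

definition base :: "nat list \<Rightarrow> nat" where
  "base s = depot (hd s) (last s)"

definition tour :: "nat list \<Rightarrow> nat list" where
  "tour s = base s # route (base s) (s @ [base s])"

text \<open>Grouped as the machine accumulates it: the legs between clients while the tour is read,
  the legs from and to the depot once the last client is known.\<close>

definition tour_cost :: "nat list \<Rightarrow> nat" where
  "tour_cost s = stops_cost s + (dist nv (base s) (hd s) + dist nv (last s) (base s) + penalty (base s))"

definition demand :: "nat \<Rightarrow> nat" where "demand = input_mem I 3"

definition gas_ok :: "nat \<Rightarrow> bool" where "gas_ok x \<longleftrightarrow> (\<forall>g. gas I = Some g \<longrightarrow> x \<le> g)"

definition tour_ok :: "nat list \<Rightarrow> bool" where
  "tour_ok s \<longleftrightarrow> sum_list (map demand s) \<le> input_mem I 0 2 \<and> gas_ok (tour_cost s)"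

definition plan :: "nat list list \<Rightarrow> bool" where
  "plan ss \<longleftrightarrow> [] \<notin> set ss \<and> distinct (concat ss) \<and> set (concat ss) = clients I \<and>
    length ss \<le> vehicles I \<and> (\<forall>s \<in> set ss. tour_ok s)"

definition plan_cost :: "nat list list \<Rightarrow> nat" where
  "plan_cost ss = sum_list (map tour_cost ss)"

lemma verts_eq: "verts I = {..<nv}"
  using verts by (simp add: nv_def)

lemma nv_pos: "0 < nv"
  using inst verts_eq by (auto simp: cvrp_instance_def)

lemma edge_verts: "{u, v} \<in> edges I \<Longrightarrow> u < nv \<and> v < nv \<and> u \<noteq> v"
  using inst verts_eq by (force simp: cvrp_instance_def)

lemma weight_le_wsum:
  assumes "e \<in> edges I"
  shows "weight I e \<le> wsum"
proof -
  have "card e = 2" using inst assms by (simp add: cvrp_instance_def)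
  then obtain u v where e: "e = {u, v}" by (auto simp: card_2_iff)
  with assms have *: "u < nv" "v < nv" using edge_verts by blast+
  then have "u * nv + v < Suc u * nv" "Suc u * nv \<le> nv * nv" by (simp, intro mult_right_mono) auto
  then have i: "u * nv + v < nv * nv" by linarith
  have "input_mem I 5 (u * nv + v) = weight I e"
    using * assms e by (simp add: input_mem_def Let_def flip: nv_def)
  then show ?thesis unfolding wsum_def using i by (metis finite_lessThan lessThan_iff member_le_sum zero_le)
qed

section \<open>Shortest walks with a bounded number of edges\<close>

lemma dist_refl [simp]: "v < nv \<Longrightarrow> dist k v v = 0"
proof (induction k)
  case (Suc k)
  have "dist (Suc k) v v \<le> cost v v + dist k v v"
    using Suc argmin_le[of v nv "\<lambda>w. cost v w + dist k w v"] by (simp add: Let_def)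
  then show ?case using Suc by (simp add: cost_def)
qed simp

lemma dist_le_walk_weight:
  "walk I p \<Longrightarrow> length p \<le> Suc k \<Longrightarrow> dist k (hd p) (last p) \<le> walk_weight I p"
proof (induction k arbitrary: p)
  case 0
  then show ?case by (cases p) (auto simp: walk_def)
next
  case (Suc k)
  then obtain u q where p: "p = u # q" by (cases p) (auto simp: walk_def)
  show ?case
  proof (cases q)
    case Nil
    then show ?thesis using Suc.prems p verts_eq dist_refl[of u "Suc k"] by (auto simp del: dist.simps)
  next
    case (Cons v r)
    then have e: "{u, v} \<in> edges I" and v: "v < nv" "u \<noteq> v"
      using Suc.prems p edge_verts[of u v] by auto
    have "dist (Suc k) u (last p) \<le> cost u v + dist k v (last p)"
      using v argmin_le[of v nv "\<lambda>w. cost u w + dist k w (last p)"] by (simp add: Let_def)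
    moreover have "dist k v (last p) \<le> walk_weight I (v # r)"
      using Suc.IH[of "v # r"] Suc.prems p Cons by simp
    ultimately show ?thesis using p Cons e v by (simp add: cost_def)
  qed
qed

text \<open>Both bounds come from a walk without repeated vertices. The second one is independent of
  \<open>p\<close>, whose weight can be arbitrarily large; it is what makes a finite
  \<open>big\<close> possible.\<close>

lemma dist_walk:
  assumes "walk I p"
  shows "dist nv (hd p) (last p) \<le> walk_weight I p" "dist nv (hd p) (last p) \<le> nv * wsum"
proof -
  obtain q where q: "walk I q" "hd q = hd p" "last q = last p" "distinct q"
    "walk_weight I q \<le> walk_weight I p"
    using walk_distinct[OF assms] by blast
  have "card (set q) \<le> card {..<nv}"
    using q verts_eq by (intro card_mono) (auto simp: walk_def)
  then have l: "length q \<le> nv" using q(4) by (simp add: distinct_card)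
  then have d: "dist nv (hd p) (last p) \<le> walk_weight I q"
    using dist_le_walk_weight[of q nv] q by simp
  then show "dist nv (hd p) (last p) \<le> walk_weight I p" using q by simp
  have "walk_weight I q \<le> (length q - 1) * wsum" using walk_weight_le weight_le_wsum q by blast
  also have "\<dots> \<le> nv * wsum" using l by (intro mult_right_mono) auto
  finally show "dist nv (hd p) (last p) \<le> nv * wsum" using d by simp
qed

text \<open>A sum below \<open>big\<close> has only summands below \<open>big\<close>, so no missing
  edge was charged and every recorded hop is an edge or a free step.\<close>

lemma path_walk:
  "u < nv \<Longrightarrow> dist k u v < big \<Longrightarrow>
    walk I (u # path k u v) \<and> last (u # path k u v) = v \<and> walk_weight I (u # path k u v) = dist k u v"
proof (induction k arbitrary: u)
  case 0
  then show ?case using verts_eq by (auto split: if_splits)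
next
  case (Suc k)
  let ?h = "hop k u v"
  have d: "dist (Suc k) u v = cost u ?h + dist k ?h v" by (simp add: hop_def Let_def)
  have h: "?h < nv" unfolding hop_def using nv_pos by (rule argmin_less)
  have IH: "walk I (?h # path k ?h v)" "last (?h # path k ?h v) = v"
    "walk_weight I (?h # path k ?h v) = dist k ?h v"
    using Suc.IH[OF h] Suc.prems d by auto
  show ?case
  proof (cases "?h = u")
    case True
    then show ?thesis using IH d by (simp add: cost_def del: dist.simps)
  next
    case False
    then have "{u, ?h} \<in> edges I" using Suc.prems d by (auto simp: cost_def split: if_splits)
    then show ?thesis using IH d False Suc.prems verts_eq by (simp add: cost_def del: dist.simps)
  qed
qed

lemma route_walk:
  "u < nv \<Longrightarrow> stops_cost (u # s) < big \<Longrightarrow>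
    walk I (u # route u s) \<and> last (u # route u s) = last (u # s) \<and>
    walk_weight I (u # route u s) = stops_cost (u # s) \<and> set s \<subseteq> set (u # route u s)"
proof (induction s arbitrary: u)
  case Nil
  then show ?case using verts_eq by simp
next
  case (Cons v s)
  let ?p = "path nv u v"
  have p: "walk I (u # ?p)" "last (u # ?p) = v" "walk_weight I (u # ?p) = dist nv u v"
    using path_walk[of u nv v] Cons.prems by auto
  then have "v < nv" using verts_eq last_in_set[of "u # ?p"] unfolding walk_def by auto
  then have IH: "walk I (v # route v s)" "last (v # route v s) = last (v # s)"
    "walk_weight I (v # route v s) = stops_cost (v # s)" "set s \<subseteq> set (v # route v s)"
    using Cons.IH[of v] Cons.prems by auto
  \<comment> \<open>The leg ends in \<open>v\<close>, which is also the start of the remaining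
    route. Exposing this shared vertex makes the append rules for walks applicable, even when the
    leg is just \<open>[u]\<close> with \<open>u = v\<close>.\<close>
  obtain q where q: "u # ?p = q @ [v]"
    using p(2) append_butlast_last_id[of "u # ?p"] by (metis list.discI)
  have r: "u # route u (v # s) = q @ v # route v s" using q by simp
  have "set s \<subseteq> set (q @ v # route v s)" using IH(4) by auto
  moreover have "walk I (q @ v # route v s)"
    using walk_append[of I q v "route v s"] p(1) q IH(1) by simp
  moreover have "walk_weight I (q @ v # route v s) = stops_cost (u # v # s)"
    using walk_weight_append[of I q v "route v s"] p(3) q IH(3) by simp
  moreover have "last (q @ v # route v s) = last (u # v # s)" using IH(2) by simp
  ultimately show ?case unfolding r by auto
qed

text \<open>Cut \<open>p\<close> at the occurrence of the first stop: the piece before it bounds the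
  first leg, and the remaining stops embed into the piece that starts there. The same cut serves the
  bound in terms of the number of legs.\<close>

lemma stops_cost_walk:
  "walk I p \<Longrightarrow> subseq s p \<Longrightarrow>
    stops_cost (hd p # s @ [last p]) \<le> walk_weight I p \<and>
    stops_cost (hd p # s @ [last p]) \<le> (length s + 1) * (nv * wsum)"
proof (induction s arbitrary: p)
  case Nil
  then show ?case using dist_walk[OF Nil(1)] by simp
next
  case (Cons a s)
  obtain q r where p: "p = q @ a # r" and s: "subseq s r"
    using list_emb_ConsD[OF Cons.prems(2)] by auto
  have w: "walk I (q @ [a])" "walk I (a # r)"
    using Cons.prems(1) walk_append[of I q a r] unfolding p by blast+
  have h: "hd (q @ [a]) = hd p" unfolding p by (cases q) auto
  have "subseq s (a # r)" using s by (rule list_emb_Cons)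
  from Cons.IH[OF w(2) this]
  have IH: "stops_cost (a # s @ [last p]) \<le> walk_weight I (a # r)"
    "stops_cost (a # s @ [last p]) \<le> (length s + 1) * (nv * wsum)"
    unfolding p by simp_all
  have "dist nv (hd p) a \<le> walk_weight I (q @ [a])" "dist nv (hd p) a \<le> nv * wsum"
    using dist_walk[OF w(1)] h by simp_all
  moreover have "walk_weight I p = walk_weight I (q @ [a]) + walk_weight I (a # r)"
    unfolding p by (rule walk_weight_append)
  moreover have "stops_cost (hd p # (a # s) @ [last p]) = dist nv (hd p) a + stops_cost (a # s @ [last p])"
    by simp
  moreover have "(length (a # s) + 1) * (nv * wsum) = nv * wsum + (length s + 1) * (nv * wsum)"
    by simp
  ultimately show ?case using IH by linarith
qed

lemma stops_cost_append: "s \<noteq> [] \<Longrightarrow> stops_cost (s @ [v]) = stops_cost s + dist nv (last s) v"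
  by (induction s rule: stops_cost.induct) auto

lemma tour_cost_eq:
  "s \<noteq> [] \<Longrightarrow> tour_cost s = stops_cost (base s # s @ [base s]) + penalty (base s)"
  using stops_cost_append[of s "base s"] by (cases s) (auto simp: tour_cost_def)

text \<open>The depot at which \<open>p\<close> starts and ends is one candidate in the minimum
  defining \<open>depot\<close>, and its penalty is 0.\<close>

lemma tour_cost_walk:
  assumes p: "walk I p" "hd p \<in> depots I" "hd p = last p" and s: "subseq s p" "s \<noteq> []"
  shows "tour_cost s \<le> walk_weight I p" "tour_cost s \<le> (length s + 1) * (nv * wsum)"
proof -
  have d: "hd p < nv" using p(1) verts_eq hd_in_set[of p] unfolding walk_def by blast
  have "tour_cost s \<le> stops_cost s + (dist nv (hd p) (hd s) + dist nv (last s) (hd p) + penalty (hd p))"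
    unfolding tour_cost_def base_def depot_def by (intro add_left_mono argmin_le d)
  also have "\<dots> = stops_cost (hd p # s @ [last p])"
    using stops_cost_append[OF s(2)] p s by (cases s) (auto simp: penalty_def)
  finally show "tour_cost s \<le> walk_weight I p" "tour_cost s \<le> (length s + 1) * (nv * wsum)"
    using stops_cost_walk[OF p(1) s(1)] by auto
qed

section \<open>Exchange between routings and plans\<close>

lemma set_clist: "set clist = clients I"
  using inst verts_eq by (auto simp: clist_def cvrp_instance_def)

lemma distinct_clist: "distinct clist"
  by (simp add: clist_def)

lemma finite_clients: "finite (clients I)"
  using set_clist finite_set by metis

lemma length_clist: "length clist = card (clients I)"
  using distinct_card[OF distinct_clist] set_clist by simp

lemma length_clist_le: "length clist \<le> nv"
  unfolding clist_def by (metis length_filter_le diff_zero length_upt)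

lemma demand_sum:
  assumes "load I = Some (l, dem)" "distinct s" "set s \<subseteq> clients I"
  shows "sum_list (map demand s) = (\<Sum>v \<in> set s. dem v)"
proof -
  have "sum_list (map demand s) = (\<Sum>v \<in> set s. demand v)"
    using assms(2) by (simp add: sum_list_distinct_conv_sum_set)
  also have "\<dots> = (\<Sum>v \<in> set s. dem v)"
    using assms by (intro sum.cong) (auto simp: demand_def input_mem_def Let_def)
  finally show ?thesis .
qed

text \<open>Without a load constraint, demands and capacity both read 0 in memory, so the test
  succeeds by itself.\<close>

lemma load_ok_iff:
  assumes "distinct s" "set s \<subseteq> clients I"
  shows "sum_list (map demand s) \<le> input_mem I 0 2 \<longleftrightarrow>
    (\<forall>l dem. load I = Some (l, dem) \<longrightarrow> (\<Sum>v \<in> set s. dem v) \<le> l)"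
proof (cases "load I")
  case None
  then have "demand = (\<lambda>_. 0)" by (simp add: demand_def input_mem_def Let_def fun_eq_iff)
  then show ?thesis using None by simp
next
  case (Some ld)
  then obtain l dem where "load I = Some (l, dem)" by (cases ld) auto
  then show ?thesis using demand_sum[OF _ assms] by (simp add: input_mem_def Let_def)
qed

lemma plan_of_routing:
  assumes "routing I R A"
  shows "\<exists>ss. plan ss \<and> plan_cost ss \<le> routing_weight I R \<and> plan_cost ss < big"
proof -
  let ?X = "\<lambda>i. {v \<in> clients I. A v = i}"
  have "\<exists>s. subseq s (R ! i) \<and> distinct s \<and> set s = ?X i" if "i < length R" for i
    by (rule ex_subseq_set) (use assms in \<open>auto simp: routing_def\<close>)
  then obtain f where f: "\<And>i. i < length R \<Longrightarrow> subseq (f i) (R ! i) \<and> distinct (f i) \<and> set (f i) = ?X i"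
    by metis
  \<comment> \<open>Vehicles without clients are dropped, because a plan contains no empty
    tour.\<close>
  let ?is = "filter (\<lambda>i. f i \<noteq> []) [0..<length R]"
  let ?ss = "map f ?is"
  have w: "tour_cost (f i) \<le> walk_weight I (R ! i)" "tour_cost (f i) \<le> (length (f i) + 1) * (nv * wsum)"
    if "i < length R" "f i \<noteq> []" for i
  proof -
    have "R ! i \<in> set R" using that(1) by simp
    then have "walk I (R ! i)" "hd (R ! i) \<in> depots I" "hd (R ! i) = last (R ! i)"
      using assms unfolding routing_def by blast+
    then show "tour_cost (f i) \<le> walk_weight I (R ! i)"
      "tour_cost (f i) \<le> (length (f i) + 1) * (nv * wsum)"
      using tour_cost_walk[of "R ! i" "f i"] f[OF that(1)] that(2) by blast+
  qed
  have "set (concat ?ss) = clients I"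
  proof -
    have "set (concat ?ss) = (\<Union>i<length R. set (f i))" by auto
    also have "\<dots> = (\<Union>i<length R. ?X i)" using f by (intro SUP_cong) simp_all
    also have "\<dots> = clients I" using assms by (auto simp: routing_def)
    finally show ?thesis .
  qed
  moreover have d: "distinct (concat ?ss)"
  proof (rule distinct_concat)
    \<comment> \<open>Tours of different vehicles differ because a nonempty tour contains a client,
      and \<open>A\<close> determines its vehicle.\<close>
    show "distinct ?ss"
    proof (subst distinct_map, intro conjI inj_onI)
      fix i j assume ij: "i \<in> set ?is" "j \<in> set ?is" "f i = f j"
      then have "i < length R" "j < length R" "f i \<noteq> []" by auto
      then have i: "set (f i) = ?X i" and j: "set (f j) = ?X j" using f[of i] f[of j] by simp_all
      obtain v where "v \<in> set (f i)" using \<open>f i \<noteq> []\<close> by (cases "f i") auto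
      moreover from this have "v \<in> set (f j)" unfolding ij(3) .
      ultimately have "A v = i" "A v = j" unfolding i j by blast+
      then show "i = j" by simp
    qed simp
    show "distinct s" if "s \<in> set ?ss" for s
    proof -
      from that obtain i where "s = f i" "i < length R" by auto
      then show ?thesis using f[of i] by simp
    qed
    show "set s \<inter> set s' = {}" if "s \<in> set ?ss" "s' \<in> set ?ss" "s \<noteq> s'" for s s'
    proof -
      from that obtain i j where ij: "s = f i" "s' = f j" "i < length R" "j < length R" by auto
      then have "set s = ?X i" "set s' = ?X j" "i \<noteq> j" using f that(3) by blast+
      then show ?thesis by auto
    qed
  qed
  ultimately have len: "length (concat ?ss) \<le> nv"
    using length_clist_le length_clist distinct_card[OF d] by simp
  have "tour_ok s" if "s \<in> set ?ss" for s
  proof -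
    from that obtain i where i: "s = f i" "i < length R" "f i \<noteq> []" by auto
    have "walk_weight I (R ! i) \<le> g" if "gas I = Some g" for g
      using assms nth_mem[OF i(2)] that unfolding routing_def by blast
    then have "gas_ok (tour_cost s)"
      using w(1)[OF i(2,3)] unfolding gas_ok_def i(1) by (meson le_trans)
    moreover have s: "distinct s" "set s = ?X i" using f[OF i(2)] i(1) by blast+
    moreover have "sum_list (map demand s) \<le> input_mem I 0 2"
      using load_ok_iff[of s] s assms i(2) unfolding routing_def by auto
    ultimately show ?thesis unfolding tour_ok_def by blast
  qed
  moreover have "length ?ss \<le> vehicles I"
  proof -
    have "length ?ss \<le> length R"
      using length_filter_le[of "\<lambda>i. f i \<noteq> []" "[0..<length R]"] by simp
    also have "\<dots> \<le> vehicles I" using assms by (simp add: routing_def)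
    finally show ?thesis .
  qed
  moreover have "[] \<notin> set ?ss" by auto
  ultimately have "plan ?ss"
    unfolding plan_def using d \<open>set (concat ?ss) = clients I\<close> by blast
  moreover have "plan_cost ?ss \<le> routing_weight I R"
  proof -
    have "plan_cost ?ss = (\<Sum>i\<leftarrow>?is. tour_cost (f i))" by (simp add: plan_cost_def comp_def)
    also have "\<dots> \<le> (\<Sum>i\<leftarrow>?is. walk_weight I (R ! i))" using w(1) by (intro sum_list_mono) auto
    also have "\<dots> \<le> (\<Sum>i\<leftarrow>[0..<length R]. walk_weight I (R ! i))"
      by (intro sum_list_filter_le_nat)
    also have "\<dots> = routing_weight I R"
      unfolding routing_weight_def by (intro arg_cong[where f = sum_list] nth_equalityI) simp_all
    finally show ?thesis .
  qed
  moreover have "plan_cost ?ss < big"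
  proof -
    have "plan_cost ?ss = (\<Sum>s\<leftarrow>?ss. tour_cost s)" by (simp add: plan_cost_def)
    also have "\<dots> \<le> (\<Sum>s\<leftarrow>?ss. length s * (nv * (wsum + wsum)))"
    proof (rule sum_list_mono)
      fix s assume "s \<in> set ?ss"
      then obtain i where i: "s = f i" "i < length R" "f i \<noteq> []" by auto
      then have "length s \<noteq> 0" by simp
      \<comment> \<open>A tour of L clients has L + 1 legs, each of cost at most
        \<open>nv * wsum\<close>. As L > 0 this is at most 2 L legs, and the L sum up to at most
        \<open>nv\<close>; hence the constant in \<open>big\<close>.\<close>
      then have "length s + 1 \<le> length s * 2" by linarith
      then have "(length s + 1) * (nv * wsum) \<le> length s * 2 * (nv * wsum)" by (rule mult_right_mono) simp
      also have "\<dots> = length s * (nv * (wsum + wsum))" by (simp add: algebra_simps)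
      finally show "tour_cost s \<le> length s * (nv * (wsum + wsum))"
        using w(2)[OF i(2,3)] unfolding i(1) by (rule order_trans[rotated])
    qed
    also have "\<dots> = length (concat ?ss) * (nv * (wsum + wsum))"
      unfolding length_concat by (rule sum_list_mult_const)
    also have "\<dots> \<le> nv * (nv * (wsum + wsum))" using len by (rule mult_right_mono) simp
    finally show ?thesis unfolding big_def mult.assoc by linarith
  qed
  ultimately show ?thesis by blast
qed

text \<open>A total below \<open>big\<close> excludes missing edges and penalties in each tour, so
  the tours are real walks from depots whose weight is their cost. The tours contain exactly the
  clients, so the condition fixes \<open>A\<close> on all of them.\<close>

lemma routing_of_plan:
  assumes ss: "plan ss" "plan_cost ss < big"
    and A: "\<And>j v. j < length ss \<Longrightarrow> v \<in> set (ss ! j) \<Longrightarrow> A v = j"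
  shows "routing I (map tour ss) A" "routing_weight I (map tour ss) = plan_cost ss"
proof -
  have tc: "tour_cost s < big" if "s \<in> set ss" for s
    using member_le_sum_list[of "tour_cost s" "map tour_cost ss"] that ss(2) by (simp add: plan_cost_def)
  have t: "walk I (tour s)" "hd (tour s) \<in> depots I" "hd (tour s) = last (tour s)"
    "walk_weight I (tour s) = tour_cost s" "set s \<subseteq> set (tour s)" if "s \<in> set ss" for s
  proof -
    have "s \<noteq> []" using that ss by (auto simp: plan_def)
    with tc[OF that] have c: "stops_cost (base s # s @ [base s]) + penalty (base s) < big"
      and e: "tour_cost s = stops_cost (base s # s @ [base s]) + penalty (base s)"
      using tour_cost_eq by auto
    then have p: "penalty (base s) = 0" "base s \<in> depots I" by (auto simp: penalty_def split: if_splits)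
    have "base s < nv" unfolding base_def depot_def using nv_pos by (rule argmin_less)
    from route_walk[OF this, of "s @ [base s]"] c e p
    show "walk I (tour s)" "hd (tour s) \<in> depots I" "hd (tour s) = last (tour s)"
      "walk_weight I (tour s) = tour_cost s" "set s \<subseteq> set (tour s)"
      unfolding tour_def by (auto simp del: route.simps)
  qed
  show "routing_weight I (map tour ss) = plan_cost ss"
    unfolding routing_weight_def plan_cost_def map_map comp_def using t(4) by (metis (no_types, lifting) map_cong)
  have U: "clients I = (\<Union>s\<in>set ss. set s)" using ss by (auto simp: plan_def)
  have c: "\<exists>j<length ss. v \<in> set (ss ! j) \<and> A v = j" if "v \<in> clients I" for v
    using that A unfolding U by (metis UN_E in_set_conv_nth)
  have X: "{v \<in> clients I. A v = j} = set (ss ! j)" if "j < length ss" for j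
  proof
    show "{v \<in> clients I. A v = j} \<subseteq> set (ss ! j)" using c by blast
    show "set (ss ! j) \<subseteq> {v \<in> clients I. A v = j}" using A that unfolding U by auto
  qed
  have "(\<Sum>v | v \<in> clients I \<and> A v = j. dem v) \<le> l" if l: "load I = Some (l, dem)" and j: "j < length ss" for l dem j
  proof -
    have "tour_ok (ss ! j)" "distinct (ss ! j)" "set (ss ! j) \<subseteq> clients I"
      using ss j nth_mem[OF j] unfolding plan_def by (auto simp: distinct_concat_iff)
    then have "(\<Sum>v \<in> set (ss ! j). dem v) \<le> l"
      using load_ok_iff[of "ss ! j"] l unfolding tour_ok_def by blast
    then show ?thesis using X[OF j] by simp
  qed
  moreover have "walk_weight I (tour s) \<le> g" if "gas I = Some g" "s \<in> set ss" for g s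
    using ss that t(4) by (auto simp: plan_def tour_ok_def gas_ok_def)
  moreover have "A v < length ss" "v \<in> set (tour (ss ! A v))" if "v \<in> clients I" for v
    using c[OF that] t(5) nth_mem by blast+
  ultimately show "routing I (map tour ss) A"
    using t(1-3) ss(1) unfolding routing_def by (auto simp: plan_def)
qed

end

section \<open>Encoding plans by numbers\<close>

text \<open>Horner's scheme, least significant digit first: \<open>d 0 + b * t\<close>, where
  \<open>t\<close> encodes the other digits.\<close>

lemma ex_digits:
  fixes b :: nat
  assumes "\<And>i. i < k \<Longrightarrow> d i < b"
  shows "\<exists>t < b ^ k. \<forall>i < k. t div b ^ i mod b = d i"
  using assms
proof (induction k arbitrary: d)
  case (Suc k)
  have "\<exists>t < b ^ k. \<forall>i < k. t div b ^ i mod b = d (Suc i)"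
    by (rule Suc.IH) (use Suc.prems in simp)
  then obtain t where t: "t < b ^ k" "\<And>i. i < k \<Longrightarrow> t div b ^ i mod b = d (Suc i)"
    by blast
  have d0: "d 0 < b" using Suc.prems by simp
  let ?t = "d 0 + b * t"
  have "?t div b ^ i mod b = d i" if "i < Suc k" for i
  proof (cases i)
    case 0
    then show ?thesis using d0 by simp
  next
    case (Suc j)
    have "?t div b = t" using d0 by simp
    then show ?thesis using t(2)[of j] that Suc by (simp add: div_mult2_eq)
  qed
  moreover have "?t < b ^ Suc k"
  proof -
    have "?t < b + b * t" using d0 by simp
    also have "\<dots> = b * Suc t" by simp
    also have "\<dots> \<le> b * b ^ k" using t(1) by (intro mult_left_mono) auto
    finally show ?thesis by simp
  qed
  ultimately show ?case by blast
qed simp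

section \<open>Words and the plans they denote\<close>

context vrp
begin

text \<open>The letters of a word range over two copies of the clients: a letter of the second copy
  also ends the current tour.\<close>

definition nc :: nat where "nc = length clist"

definition client :: "nat \<Rightarrow> nat" where "client d = (clist @ clist) ! d"

text \<open>The pair consists of the completed tours and the clients of the tour that is still open;
  the machine scans a word in the same way.\<close>

definition decode_letter :: "nat list list \<times> nat list \<Rightarrow> nat \<Rightarrow> nat list list \<times> nat list" where
  "decode_letter x d =
    (if d < nc then (fst x, snd x @ [client d]) else (fst x @ [snd x @ [client d]], []))"

definition decode :: "nat list \<Rightarrow> nat list list \<times> nat list" where
  "decode w = foldl decode_letter ([], []) w"

text \<open>The least significant digit comes first, so reading a word means iterating one table of
  quotients. Without clients there is one word, the empty one, in accordance with
  \<open>0 ^ 0 = 1\<close>.\<close>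

definition word :: "nat \<Rightarrow> nat list" where
  "word t = map (\<lambda>i. t div (nc + nc) ^ i mod (nc + nc)) [0..<nc]"

definition tours_of :: "nat \<Rightarrow> nat list list" where
  "tours_of t = fst (decode (word t))"

definition valid :: "nat \<Rightarrow> bool" where
  "valid t \<longleftrightarrow> snd (decode (word t)) = [] \<and> plan (tours_of t)"

text \<open>Invalid words score as much as the initial value of the search, so they can never be
  selected.\<close>

definition score :: "nat \<Rightarrow> nat" where
  "score t = (if valid t then plan_cost (tours_of t) else big)"

lemma decode_Nil [simp]: "decode [] = ([], [])"
  by (simp add: decode_def)

lemma decode_snoc [simp]: "decode (w @ [d]) = decode_letter (decode w) d"
  by (simp add: decode_def)

text \<open>Decoding merely brackets the word, so questions about repeated clients can be asked of
  the word itself.\<close>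

lemma concat_decode: "concat (fst (decode w)) @ snd (decode w) = map client w"
proof (induction w rule: rev_induct)
  case (snoc d w)
  then show ?case by (auto simp: decode_letter_def simp flip: append_assoc)
qed simp

lemma Nil_notin_decode: "[] \<notin> set (fst (decode w))"
  by (induction w rule: rev_induct) (auto simp: decode_letter_def)

lemma length_word [simp]: "length (word t) = nc"
  by (simp add: word_def)

lemma word_less: "d \<in> set (word t) \<Longrightarrow> d < nc + nc"
  by (cases nc) (auto simp: word_def)

lemma client_in: "d < nc + nc \<Longrightarrow> client d \<in> clients I"
  using nth_mem[of d "clist @ clist"] set_clist by (simp add: client_def nc_def)

text \<open>A word has as many letters as there are clients. If they denote distinct clients, then
  all clients occur, so completeness needs no test of its own.\<close>

lemma plan_tours_of_iff:
  assumes "snd (decode (word t)) = []"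
  shows "plan (tours_of t) \<longleftrightarrow> distinct (map client (word t)) \<and>
    length (tours_of t) \<le> vehicles I \<and> (\<forall>s \<in> set (tours_of t). tour_ok s)"
proof -
  have c: "concat (tours_of t) = map client (word t)"
    using concat_decode[of "word t"] assms by (simp add: tours_of_def)
  have "set (map client (word t)) = clients I" if "distinct (map client (word t))"
  proof (rule card_subset_eq)
    show "set (map client (word t)) \<subseteq> clients I" using client_in word_less by auto
    show "card (set (map client (word t))) = card (clients I)"
      using distinct_card[OF that] length_clist nc_def by simp
  qed (rule finite_clients)
  then show ?thesis
    unfolding plan_def c using Nil_notin_decode[of "word t"] by (auto simp: tours_of_def)
qed

lemma ex_word:
  assumes "plan ss"
  shows "\<exists>t < (nc + nc) ^ nc. decode (word t) = (ss, [])"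
proof -
  define ix where "ix v = (SOME i. i < nc \<and> clist ! i = v)" for v
  have ix: "ix v < nc" "clist ! ix v = v" if "v \<in> clients I" for v
    using someI_ex[of "\<lambda>i. i < nc \<and> clist ! i = v"] that set_clist
    unfolding ix_def nc_def by (metis in_set_conv_nth)+
  \<comment> \<open>The last client of a tour is taken from the second copy of the clients, which
    closes the tour when decoded.\<close>
  define enc where "enc s = map ix (butlast s) @ [nc + ix (last s)]" for s
  have step: "foldl decode_letter (xs, ys) (map ix s) = (xs, ys @ s)" if "set s \<subseteq> clients I" for xs ys s
    using that
  proof (induction s arbitrary: ys)
    case (Cons v s)
    then show ?case using ix[of v] by (simp add: decode_letter_def client_def nth_append nc_def)
  qed simp
  have enc: "foldl decode_letter (xs, []) (enc s) = (xs @ [s], [])"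
    if s: "s \<noteq> []" "set s \<subseteq> clients I" for xs s
  proof -
    have "set (butlast s) \<subseteq> clients I" using s in_set_butlastD[of _ s] by auto
    moreover have "last s \<in> clients I" using s by auto
    ultimately show ?thesis
      using step[of "butlast s" xs "[]"] s ix[of "last s"]
      by (simp add: enc_def decode_letter_def client_def nth_append nc_def)
  qed
  have dec: "foldl decode_letter (xs, []) (concat (map enc ss)) = (xs @ ss, [])"
    if "[] \<notin> set ss" "set (concat ss) \<subseteq> clients I" for xs ss
    using that
  proof (induction ss arbitrary: xs)
    case (Cons s ss)
    from Cons.prems have "s \<noteq> []" by auto
    then show ?case using Cons enc[of s xs] by simp
  qed simp
  let ?w = "concat (map enc ss)"
  have ne: "s \<noteq> []" and sub: "set s \<subseteq> clients I" if "s \<in> set ss" for s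
    using assms that by (auto simp: plan_def)
  have "length ?w = length (concat ss)"
  proof -
    have "length (enc s) = length s" if "s \<in> set ss" for s using ne[OF that] by (simp add: enc_def)
    then have "map (length \<circ> enc) ss = map length ss" by simp
    then show ?thesis unfolding length_concat map_map by (rule arg_cong)
  qed
  also have "\<dots> = nc"
    using assms distinct_card[of "concat ss"] length_clist by (simp add: plan_def nc_def)
  finally have len: "length ?w = nc" .
  have "d < nc + nc" if d: "d \<in> set ?w" for d
  proof -
    from d obtain s where s: "s \<in> set ss" "d \<in> set (enc s)" by auto
    have "last s \<in> clients I" using ne[OF s(1)] sub[OF s(1)] last_in_set by blast
    then have "ix (last s) < nc" by (rule ix)
    moreover have "ix v < nc" if "v \<in> set (butlast s)" for v
      using that in_set_butlastD[OF that] sub[OF s(1)] ix(1) by blast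
    ultimately show ?thesis using s(2) unfolding enc_def by (fastforce intro: trans_less_add1)
  qed
  then have "?w ! i < nc + nc" if "i < nc" for i using that len nth_mem[of i ?w] by (simp only:)
  then obtain t where t: "t < (nc + nc) ^ nc" "\<forall>i < nc. t div (nc + nc) ^ i mod (nc + nc) = ?w ! i"
    using ex_digits[of nc "\<lambda>i. ?w ! i" "nc + nc"] by blast
  have "word t = ?w" using t(2) len by (intro nth_equalityI) (simp_all add: word_def)
  then have "decode (word t) = (ss, [])"
    using dec[of ss "[]"] assms unfolding decode_def by (simp add: plan_def)
  then show ?thesis using t(1) by blast
qed

lemma no_routing:
  assumes "\<And>t. t < (nc + nc) ^ nc \<Longrightarrow> big \<le> score t"
  shows "\<not> routing I R A"
proof
  assume "routing I R A"
  then obtain ss where ss: "plan ss" "plan_cost ss < big" using plan_of_routing by blast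
  then obtain t where t: "t < (nc + nc) ^ nc" "decode (word t) = (ss, [])" using ex_word by blast
  then have "score t = plan_cost ss" using ss by (simp add: score_def valid_def tours_of_def)
  then show False using assms[OF t(1)] ss by simp
qed

text \<open>Any competing routing dominates some plan, and this plan is the decoding of a word
  within the range over which the score was minimised.\<close>

lemma optimal_routing_tours:
  assumes small: "score t < big"
    and min: "\<And>t'. t' < (nc + nc) ^ nc \<Longrightarrow> score t \<le> score t'"
    and A: "\<And>j v. j < length (tours_of t) \<Longrightarrow> v \<in> set (tours_of t ! j) \<Longrightarrow> A v = j"
  shows "optimal_routing I (map tour (tours_of t)) A"
proof -
  have p: "plan (tours_of t)" "plan_cost (tours_of t) = score t"
    using small by (auto simp: score_def valid_def split: if_splits)
  have "score t \<le> routing_weight I R'" if R': "routing I R' A'" for R' A'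
  proof -
    obtain ss where ss: "plan ss" "plan_cost ss \<le> routing_weight I R'" using plan_of_routing[OF R'] by blast
    then obtain t' where "t' < (nc + nc) ^ nc" "decode (word t') = (ss, [])" using ex_word by blast
    then have "score t \<le> plan_cost ss"
      using min[of t'] ss by (simp add: score_def valid_def tours_of_def)
    then show ?thesis using ss by simp
  qed
  then show ?thesis
    using routing_of_plan[of "tours_of t" A] p small A unfolding optimal_routing_def by simp
qed

end

section \<open>Program building blocks\<close>

text \<open>The product is added to \<open>y\<close> instead of replacing it; the summands
  \<open>nv * nv\<close> and 1 in the table size and in \<open>big\<close> enter as initial
  values.\<close>

definition Times :: "nat \<Rightarrow> nat \<Rightarrow> expr \<Rightarrow> expr \<Rightarrow> prog" where
  "Times y x c e = For x c (y ::= Plus (Var y) e)"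

text \<open>The value for candidate 0 is computed before the loop, matching
  \<open>argmin f 0 = 0\<close>; the loop then needs no special first round.\<close>

definition Argmin :: "nat \<Rightarrow> nat \<Rightarrow> nat \<Rightarrow> expr \<Rightarrow> expr \<Rightarrow> prog" where
  "Argmin w A B c e = w ::= Const 0 ;; B ::= e ;; A ::= Const 0 ;;
    For w c (If (Less e (Var B)) (B ::= e ;; A ::= Var w) Skip)"

definition Push :: "nat \<Rightarrow> nat \<Rightarrow> expr \<Rightarrow> prog" where
  "Push a l e = Assign a (Var l) e ;; l ::= Plus (Var l) (Const 1)"

definition holds :: "mem \<Rightarrow> nat \<Rightarrow> nat \<Rightarrow> nat list \<Rightarrow> bool" where
  "holds m a l xs \<longleftrightarrow> m l 0 = length xs \<and> (\<forall>i < length xs. m a i = xs ! i)"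

lemma writes_Times [simp]: "writes (Times y x c e) = {x, y}"
  by (auto simp: Times_def)

lemma writes_Argmin [simp]: "writes (Argmin w A B c e) = {w, A, B}"
  by (auto simp: Argmin_def)

lemma writes_Push [simp]: "writes (Push a l e) = {a, l}"
  by (auto simp: Push_def)

lemma run_Seq_minus:
  "run p m S R \<Longrightarrow> S \<le> T \<Longrightarrow>
    (\<And>m'. R m' \<Longrightarrow> (\<And>a. a \<notin> writes p \<Longrightarrow> m' a = m a) \<Longrightarrow> run q m' (T - S) Q) \<Longrightarrow> run (p ;; q) m T Q"
  by (rule run_Seq[of _ _ S R _ "T - S"]) simp_all

lemma expr_val_frame:
  "reads e \<inter> S = {} \<Longrightarrow> (\<And>a. a \<notin> S \<Longrightarrow> m' a = m a) \<Longrightarrow> expr_val m' e = expr_val m e"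
  by (rule expr_val_cong) blast

lemma run_Times:
  assumes "expr_val m c = N" "expr_val m e = K" "x \<noteq> y" "reads c \<inter> {x, y} = {}" "reads e \<inter> {x, y} = {}"
  shows "run (Times y x c e) m (N * 3 + 2) (\<lambda>m'. m' y 0 = m y 0 + N * K)"
  unfolding Times_def
proof (rule run_For[where N = N and T = 1 and J = "\<lambda>i m'. m' y 0 = m y 0 + i * K"])
  fix i m'
  assume *: "m' y 0 = m y 0 + i * K" "\<And>a. a \<notin> insert x (writes (y ::= Plus (Var y) e)) \<Longrightarrow> m' a = m a"
  have "expr_val m' e = K"
    using assms(2,5) *(2) expr_val_cong[of e m' m] by (simp add: disjoint_iff)
  then show "run (y ::= Plus (Var y) e) m' 1
    (\<lambda>m''. (m''(x := (m'' x)(0 := Suc i))) y 0 = m y 0 + Suc i * K)"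
    using *(1) assms(3) by simp
qed (use assms in auto)

lemma run_Argmin:
  assumes "expr_val m c = N" "0 < N" "distinct [w, A, B]" "reads c \<inter> {w, A, B} = {}"
    and val: "\<And>i m'. i < N \<Longrightarrow> m' w 0 = i \<Longrightarrow> (\<And>a. a \<notin> {w, A, B} \<Longrightarrow> m' a = m a) \<Longrightarrow> expr_val m' e = f i"
  shows "run (Argmin w A B c e) m (N * 5 + 5) (\<lambda>m'. m' A 0 = argmin f N \<and> m' B 0 = f (argmin f N))"
proof -
  let ?m0 = "m(w := (m w)(0 := 0))"
  have e0: "expr_val ?m0 e = f 0" using assms by (intro val) auto
  let ?m = "?m0(B := (m B)(0 := f 0), A := (m A)(0 := 0))"
  have "run (For w c (If (Less e (Var B)) (B ::= e ;; A ::= Var w) Skip)) ?m (N * 5 + 2)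
    (\<lambda>m'. m' A 0 = argmin f N \<and> m' B 0 = f (argmin f N))"
  proof (rule run_For[where N = N and T = 3 and J = "\<lambda>i m'. m' A 0 = argmin f i \<and> m' B 0 = f (argmin f i)"])
    show "expr_val ?m c = N"
      using assms(1,4) expr_val_frame[of c "{w, A, B}" ?m m] by simp
    fix i m'
    assume i: "i < N" "m' w 0 = i" and J: "m' A 0 = argmin f i \<and> m' B 0 = f (argmin f i)"
      and frame: "\<And>a. a \<notin> insert w (writes (If (Less e (Var B)) (B ::= e ;; A ::= Var w) Skip)) \<Longrightarrow> m' a = ?m a"
    have f: "m' a = m a" if "a \<notin> {w, A, B}" for a using frame[of a] that by simp
    have e: "expr_val m' e = f i" using val[OF i(1,2) f] .
    show "run (If (Less e (Var B)) (B ::= e ;; A ::= Var w) Skip) m' 3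
      (\<lambda>m''. (m''(w := (m'' w)(0 := Suc i))) A 0 = argmin f (Suc i) \<and>
             (m''(w := (m'' w)(0 := Suc i))) B 0 = f (argmin f (Suc i)))"
      using e i J assms(3) by auto
  qed (use assms in auto)
  then show ?thesis
    unfolding Argmin_def using assms(3) e0 by simp
qed

text \<open>The entry for \<open>i\<close> may be computed from the entries below \<open>i\<close>,
  which covers tables defined by recurrences.\<close>

lemma run_Fill:
  assumes "expr_val m e = N" "x \<noteq> X" "x \<notin> writes p" "reads e \<inter> insert x (writes p) = {}"
    and step: "\<And>i m'. i < N \<Longrightarrow> m' x 0 = i \<Longrightarrow> (\<And>j. j < i \<Longrightarrow> m' X j = f j) \<Longrightarrow>
      (\<And>a. a \<notin> insert x (writes p) \<Longrightarrow> m' a = m a) \<Longrightarrow>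
      run p m' T (\<lambda>m''. m'' X = (m' X)(i := f i))"
    and "N * (T + 2) + 2 \<le> T'"
  shows "run (For x e p) m T' (\<lambda>m'. \<forall>j < N. m' X j = f j)"
proof (rule run_For[where N = N and T = T and J = "\<lambda>i m'. \<forall>j < i. m' X j = f j"])
  fix i m'
  assume *: "i < N" "\<forall>j<i. m' X j = f j" "m' x 0 = i" "\<And>a. a \<notin> insert x (writes p) \<Longrightarrow> m' a = m a"
  have "run p m' T (\<lambda>m''. m'' X = (m' X)(i := f i))"
    using * by (intro step) auto
  then show "run p m' T (\<lambda>m''. \<forall>j<Suc i. (m''(x := (m'' x)(0 := Suc i))) X j = f j)"
    by (rule run_weaken) (use *(2) assms(2) in \<open>auto simp: less_Suc_eq\<close>)
qed (use assms in auto)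

lemma run_Push:
  assumes "holds m a l xs" "a \<noteq> l" "expr_val m e = v" "l \<notin> reads e"
  shows "run (Push a l e) m 2 (\<lambda>m'. holds m' a l (xs @ [v]))"
  using assms by (simp add: Push_def holds_def nth_append less_Suc_eq)

section \<open>Tables of remainders, quotients and multiples\<close>

definition Mod_Table :: "nat \<Rightarrow> nat \<Rightarrow> expr \<Rightarrow> expr \<Rightarrow> prog" where
  "Mod_Table R x b c = For x c
    (If (Equal (Var x) (Const 0)) (Assign R (Var x) (Const 0))
      (If (Equal (Plus (Cell R (Minus (Var x) (Const 1))) (Const 1)) b) (Assign R (Var x) (Const 0))
        (Assign R (Var x) (Plus (Cell R (Minus (Var x) (Const 1))) (Const 1)))))"

text \<open>The quotient rises by one exactly where the remainder returns to 0.\<close>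

definition Div_Table :: "nat \<Rightarrow> nat \<Rightarrow> nat \<Rightarrow> expr \<Rightarrow> prog" where
  "Div_Table Q R x c = For x c
    (If (Equal (Var x) (Const 0)) (Assign Q (Var x) (Const 0))
      (If (Equal (Cell R (Var x)) (Const 0)) (Assign Q (Var x) (Plus (Cell Q (Minus (Var x) (Const 1))) (Const 1)))
        (Assign Q (Var x) (Cell Q (Minus (Var x) (Const 1))))))"

definition Mult_Table :: "nat \<Rightarrow> nat \<Rightarrow> expr \<Rightarrow> expr \<Rightarrow> prog" where
  "Mult_Table X x b c = For x c
    (If (Equal (Var x) (Const 0)) (Assign X (Var x) (Const 0))
      (Assign X (Var x) (Plus (Cell X (Minus (Var x) (Const 1))) b)))"

lemma writes_Tables [simp]:
  "writes (Mod_Table R x b c) = {x, R}" "writes (Div_Table Q R x c) = {x, Q}"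
  "writes (Mult_Table X x b c) = {x, X}"
  by (auto simp: Mod_Table_def Div_Table_def Mult_Table_def)

text \<open>The remainder counts up and wraps around at the divisor. Divisor 0, which occurs without
  clients, is covered: the wrap test never succeeds and \<open>j mod 0 = j\<close>.\<close>

lemma run_Mod_Table:
  assumes "expr_val m c = N" "expr_val m b = B" "x \<noteq> R" "reads c \<inter> {x, R} = {}" "reads b \<inter> {x, R} = {}"
  shows "run (Mod_Table R x b c) m (N * 5 + 2) (\<lambda>m'. \<forall>j < N. m' R j = j mod B)"
proof -
  let ?p = "(If (Equal (Var x) (Const 0)) (Assign R (Var x) (Const 0))
      (If (Equal (Plus (Cell R (Minus (Var x) (Const 1))) (Const 1)) b) (Assign R (Var x) (Const 0))
        (Assign R (Var x) (Plus (Cell R (Minus (Var x) (Const 1))) (Const 1)))))"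
  show ?thesis unfolding Mod_Table_def
proof (rule run_Fill[where T = 3])
  fix i m'
  assume *: "i < N" "m' x 0 = i" "\<And>j. j < i \<Longrightarrow> m' R j = j mod B"
    "\<And>a. a \<notin> insert x (writes ?p) \<Longrightarrow> m' a = m a"
  have b: "expr_val m' b = B"
    using assms(2,5) *(4) expr_val_frame[of b "{x, R}" m' m] by simp
  show "run ?p m' 3 (\<lambda>m''. m'' R = (m' R)(i := i mod B))"
    using *(2) *(3)[of "i - 1"] b by (cases i) (simp_all add: mod_Suc)
  qed (use assms in auto)
qed

lemma run_Div_Table:
  assumes "expr_val m c = N" "distinct [x, Q, R]" "reads c \<inter> {x, Q} = {}" "\<And>j. j < N \<Longrightarrow> m R j = j mod B"
  shows "run (Div_Table Q R x c) m (N * 5 + 2) (\<lambda>m'. \<forall>j < N. m' Q j = j div B)"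
proof -
  let ?p = "(If (Equal (Var x) (Const 0)) (Assign Q (Var x) (Const 0))
      (If (Equal (Cell R (Var x)) (Const 0)) (Assign Q (Var x) (Plus (Cell Q (Minus (Var x) (Const 1))) (Const 1)))
        (Assign Q (Var x) (Cell Q (Minus (Var x) (Const 1))))))"
  show ?thesis unfolding Div_Table_def
proof (rule run_Fill[where T = 3])
  fix i m'
  assume *: "i < N" "m' x 0 = i" "\<And>j. j < i \<Longrightarrow> m' Q j = j div B"
    "\<And>a. a \<notin> insert x (writes ?p) \<Longrightarrow> m' a = m a"
  have "m' R i = i mod B"
    using assms(2,4) *(1) *(4)[of R] by simp
  then show "run ?p m' 3 (\<lambda>m''. m'' Q = (m' Q)(i := i div B))"
    using *(2) *(3)[of "i - 1"] by (cases i) (simp_all add: div_Suc)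
  qed (use assms in auto)
qed

lemma run_Mult_Table:
  assumes "expr_val m c = N" "expr_val m b = B" "x \<noteq> X" "reads c \<inter> {x, X} = {}" "reads b \<inter> {x, X} = {}"
  shows "run (Mult_Table X x b c) m (N * 4 + 2) (\<lambda>m'. \<forall>j < N. m' X j = j * B)"
proof -
  let ?p = "(If (Equal (Var x) (Const 0)) (Assign X (Var x) (Const 0))
      (Assign X (Var x) (Plus (Cell X (Minus (Var x) (Const 1))) b)))"
  show ?thesis unfolding Mult_Table_def
proof (rule run_Fill[where T = 2])
  fix i m'
  assume *: "i < N" "m' x 0 = i" "\<And>j. j < i \<Longrightarrow> m' X j = j * B"
    "\<And>a. a \<notin> insert x (writes ?p) \<Longrightarrow> m' a = m a"
  have b: "expr_val m' b = B"
    using assms(2,5) *(4) expr_val_frame[of b "{x, X}" m' m] by simp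
  show "run ?p m' 2 (\<lambda>m''. m'' X = (m' X)(i := i * B))"
    using *(2) *(3)[of "i - 1"] b by (cases i) (simp_all add: add.commute)
  qed (use assms in auto)
qed

section \<open>Distance tables\<close>

abbreviation (input) "nE \<equiv> Cell 0 (Const 0)"

abbreviation (input) "vN2 \<equiv> 10 :: nat"
abbreviation (input) "vL \<equiv> 11 :: nat"
abbreviation (input) "vI \<equiv> 12 :: nat"
abbreviation (input) "vJ \<equiv> 13 :: nat"
abbreviation (input) "vSum \<equiv> 14 :: nat"
abbreviation (input) "vBig \<equiv> 15 :: nat"
abbreviation (input) "aRow \<equiv> 16 :: nat"
abbreviation (input) "aMod \<equiv> 17 :: nat"
abbreviation (input) "aDiv \<equiv> 18 :: nat"
abbreviation (input) "aCost \<equiv> 19 :: nat"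
abbreviation (input) "aPen \<equiv> 20 :: nat"
abbreviation (input) "aDist \<equiv> 21 :: nat"
abbreviation (input) "aHop \<equiv> 22 :: nat"
abbreviation (input) "vW \<equiv> 23 :: nat"
abbreviation (input) "vArg \<equiv> 24 :: nat"
abbreviation (input) "vMin \<equiv> 25 :: nat"

text \<open>\<open>vL\<close> becomes the number of triples (k, u, v) with k \<le>
  \<open>nv\<close>, that is \<open>nv * nv + nv * (nv * nv)\<close>; this is the length of the
  distance table.\<close>

definition sizes :: prog where
  "sizes = vN2 ::= Const 0 ;; Times vN2 vI nE nE ;; vL ::= Var vN2 ;; Times vL vI nE (Var vN2)"

definition index_tables :: prog where
  "index_tables = Mult_Table aRow vI nE (Var vL) ;; Mod_Table aMod vI nE (Var vL) ;;
    Div_Table aDiv aMod vI (Var vL)"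

definition infinity :: prog where
  "infinity = vSum ::= Const 0 ;; For vI (Var vN2) (vSum ::= Plus (Var vSum) (Cell 5 (Var vI))) ;;
    vBig ::= Const 1 ;; Times vBig vI (Var vN2) (Plus (Var vSum) (Var vSum))"

definition cost_table :: prog where
  "cost_table = For vI (Var vN2)
    (If (Equal (Cell aDiv (Var vI)) (Cell aMod (Var vI))) (Assign aCost (Var vI) (Const 0))
      (If (Equal (Cell 4 (Var vI)) (Const 1)) (Assign aCost (Var vI) (Cell 5 (Var vI)))
        (Assign aCost (Var vI) (Var vBig))))"

definition penalty_table :: prog where
  "penalty_table = For vI nE
    (If (Equal (Cell 1 (Var vI)) (Const 1)) (Assign aPen (Var vI) (Const 0)) (Assign aPen (Var vI) (Var vBig)))"

text \<open>The distance \<open>dist k u v\<close> is stored at index \<open>(k * nv + u) * nv + v\<close>; there the table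
  of the multiples of \<open>nv\<close> replaces multiplication.\<close>

abbreviation (input) Dist :: "expr \<Rightarrow> expr \<Rightarrow> expr" where
  "Dist r v \<equiv> Cell aDist (Plus (Cell aRow r) v)"

text \<open>The current index is \<open>(k * nv + u) * nv + v\<close> with k > 0. Table lookups
  yield \<open>k * nv + u\<close> and \<open>u\<close>; subtracting \<open>u\<close> and
  \<open>nv\<close> from the former leads to layer k - 1.\<close>

definition hop_cost :: expr where
  "hop_cost = Plus
    (Cell aCost (Plus (Cell aRow (Cell aMod (Cell aDiv (Var vI)))) (Var vW)))
    (Dist (Plus (Minus (Minus (Cell aDiv (Var vI)) (Cell aMod (Cell aDiv (Var vI)))) nE) (Var vW))
      (Cell aMod (Var vI)))"

definition dist_table :: prog where
  "dist_table = For vI (Var vL)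
    (If (Less (Var vI) (Var vN2))
      (If (Equal (Cell aDiv (Var vI)) (Cell aMod (Var vI))) (Assign aDist (Var vI) (Const 0))
        (Assign aDist (Var vI) (Var vBig)))
      (Argmin vW vArg vMin nE hop_cost ;; Assign aDist (Var vI) (Var vMin) ;; Assign aHop (Var vI) (Var vArg)))"

lemma writes_tables [simp]:
  "writes sizes = {vN2, vL, vI}" "writes index_tables = {aRow, aMod, aDiv, vI}"
  "writes infinity = {vSum, vBig, vI}" "writes cost_table = {aCost, vI}"
  "writes penalty_table = {aPen, vI}" "writes dist_table = {aDist, aHop, vI, vW, vArg, vMin}"
  by (auto simp: sizes_def index_tables_def infinity_def cost_table_def penalty_table_def dist_table_def)

section \<open>Contents and correctness of the distance tables\<close>

context vrp
begin

definition input :: "mem \<Rightarrow> bool" where "input m \<longleftrightarrow> (\<forall>a < 6. m a = input_mem I a)"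

lemma inputD [simp]:
  assumes "input m"
  shows "m 0 0 = nv" "m 0 (Suc 0) = vehicles I" "m 0 2 = input_mem I 0 2" "m 0 3 = input_mem I 0 3"
    "m 1 v = of_bool (v \<in> depots I)" "m (Suc 0) v = of_bool (v \<in> depots I)"
    "m 2 v = of_bool (v \<in> clients I)" "m 3 v = demand v"
    "m 4 p = of_bool ({p div nv, p mod nv} \<in> edges I)" "m 5 p = input_mem I 5 p"
  using assms by (simp_all add: input_def input_mem_def Let_def nv_def demand_def)

definition sized :: "mem \<Rightarrow> bool" where
  "sized m \<longleftrightarrow> input m \<and> m vN2 0 = nv * nv \<and> m vL 0 = nv * nv + nv * (nv * nv)"

definition indexed :: "mem \<Rightarrow> bool" where
  "indexed m \<longleftrightarrow> sized m \<and> (\<forall>p < nv * nv + nv * (nv * nv).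
    m aRow p = p * nv \<and> m aMod p = p mod nv \<and> m aDiv p = p div nv)"

definition costed :: "mem \<Rightarrow> bool" where
  "costed m \<longleftrightarrow> indexed m \<and> m vBig 0 = big \<and> (\<forall>p < nv * nv. m aCost p = cost (p div nv) (p mod nv)) \<and>
    (\<forall>d < nv. m aPen d = penalty d)"

lemma input_frame: "input m \<Longrightarrow> (\<And>a. a < 6 \<Longrightarrow> m' a = m a) \<Longrightarrow> input m'"
  by (simp add: input_def)

lemma run_sizes: "input m \<Longrightarrow> run sizes m (nv * 6 + 6) sized"
  unfolding sizes_def
  apply (simp, rule run_Seq_minus[OF run_Times[where N = nv and K = nv]], simp_all)
  apply (rule run_weaken[OF run_Times[where N = nv and K = "nv * nv"]])
         apply (simp_all add: sized_def input_def)
  done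

lemma run_index_tables:
  assumes "sized m"
  shows "run index_tables m ((nv * nv + nv * (nv * nv)) * 14 + 6) indexed"
proof -
  let ?L = "nv * nv + nv * (nv * nv)"
  have m: "m 0 0 = nv" "m vL 0 = ?L" using assms by (simp_all add: sized_def)
  show ?thesis
    unfolding index_tables_def
  proof (rule run_Seq)
    show "run (Mult_Table aRow vI nE (Var vL)) m (?L * 4 + 2) (\<lambda>m1. \<forall>j < ?L. m1 aRow j = j * nv)"
      by (rule run_Mult_Table) (simp_all add: m)
  next
    fix m1 assume 1: "\<forall>j < ?L. m1 aRow j = j * nv" "\<And>a. a \<notin> writes (Mult_Table aRow vI nE (Var vL)) \<Longrightarrow> m1 a = m a"
    show "run (Mod_Table aMod vI nE (Var vL) ;; Div_Table aDiv aMod vI (Var vL)) m1 (?L * 10 + 4) indexed"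
    proof (rule run_Seq)
      show "run (Mod_Table aMod vI nE (Var vL)) m1 (?L * 5 + 2) (\<lambda>m2. \<forall>j < ?L. m2 aMod j = j mod nv)"
        by (rule run_Mod_Table) (simp_all add: m 1(2))
    next
      fix m2 assume 2: "\<forall>j < ?L. m2 aMod j = j mod nv" "\<And>a. a \<notin> writes (Mod_Table aMod vI nE (Var vL)) \<Longrightarrow> m2 a = m1 a"
      show "run (Div_Table aDiv aMod vI (Var vL)) m2 (?L * 5 + 2) indexed"
      proof (rule run_weaken)
        show "run (Div_Table aDiv aMod vI (Var vL)) m2 (?L * 5 + 2) (\<lambda>m3. \<forall>j < ?L. m3 aDiv j = j div nv)"
          by (rule run_Div_Table) (use m 1(2) 2 in simp_all)
        fix m3 assume 3: "\<forall>j < ?L. m3 aDiv j = j div nv" "\<And>a. a \<notin> writes (Div_Table aDiv aMod vI (Var vL)) \<Longrightarrow> m3 a = m2 a"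
        show "indexed m3"
          using assms 1 2 3 by (simp add: indexed_def sized_def input_def)
      qed simp
    qed simp
  qed simp
qed

lemma run_infinity:
  assumes "indexed m"
  shows "run infinity m (nv * nv * 6 + 6) (\<lambda>m'. m' vBig 0 = big)"
proof -
  let ?p = "For vI (Var vN2) (vSum ::= Plus (Var vSum) (Cell 5 (Var vI)))"
  let ?q = "Times vBig vI (Var vN2) (Plus (Var vSum) (Var vSum))"
  let ?m = "m(vSum := (m vSum)(0 := 0))"
  have m: "input m" "m vN2 0 = nv * nv" using assms by (simp_all add: indexed_def sized_def)
  have "run (?p ;; vBig ::= Const 1 ;; ?q) ?m (nv * nv * 6 + 5) (\<lambda>m'. m' vBig 0 = big)"
  proof (rule run_Seq)
    show "run ?p ?m (nv * nv * 3 + 2) (\<lambda>m'. m' vSum 0 = wsum)"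
      by (rule run_For[where N = "nv * nv" and T = 1 and J = "\<lambda>i m'. m' vSum 0 = (\<Sum>j<i. input_mem I 5 j)"])
        (simp_all add: m wsum_def)
  next
    fix m1 assume 1: "m1 vSum 0 = wsum" "\<And>a. a \<notin> writes ?p \<Longrightarrow> m1 a = ?m a"
    let ?m1 = "m1(vBig := (m1 vBig)(0 := 1))"
    have "run ?q ?m1 (nv * nv * 3 + 2) (\<lambda>m'. m' vBig 0 = ?m1 vBig 0 + nv * nv * (wsum + wsum))"
      by (rule run_Times) (simp_all add: m 1)
    then show "run (vBig ::= Const 1 ;; ?q) m1 (nv * nv * 3 + 3) (\<lambda>m'. m' vBig 0 = big)"
      by (simp add: big_def)
  qed simp
  from run_weaken[OF this] show ?thesis unfolding infinity_def by simp
qed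

lemma run_cost_table:
  assumes "indexed m" "m vBig 0 = big"
  shows "run cost_table m (nv * nv * 5 + 2) (\<lambda>m'. \<forall>p < nv * nv. m' aCost p = cost (p div nv) (p mod nv))"
  unfolding cost_table_def
proof (rule run_Fill[where T = 3])
  show "expr_val m (Var vN2) = nv * nv" using assms by (simp add: indexed_def sized_def)
  let ?p = "If (Equal (Cell aDiv (Var vI)) (Cell aMod (Var vI))) (Assign aCost (Var vI) (Const 0))
      (If (Equal (Cell 4 (Var vI)) (Const 1)) (Assign aCost (Var vI) (Cell 5 (Var vI)))
        (Assign aCost (Var vI) (Var vBig)))"
  fix i m'
  assume i: "i < nv * nv" "m' vI 0 = i" and f: "\<And>a. a \<notin> insert vI (writes ?p) \<Longrightarrow> m' a = m a"
  have "m aDiv i = i div nv" "m aMod i = i mod nv" "input m" using assms i by (simp_all add: indexed_def sized_def)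
  then show "run ?p m' 3 (\<lambda>m''. m'' aCost = (m' aCost)(i := cost (i div nv) (i mod nv)))"
    using i assms(2) by (simp add: f cost_def) (simp add: input_mem_def Let_def flip: nv_def)
qed simp_all

lemma run_penalty_table:
  assumes "input m" "m vBig 0 = big"
  shows "run penalty_table m (nv * 4 + 2) (\<lambda>m'. \<forall>d < nv. m' aPen d = penalty d)"
  unfolding penalty_table_def
proof (rule run_Fill[where T = 2])
  let ?p = "If (Equal (Cell 1 (Var vI)) (Const 1)) (Assign aPen (Var vI) (Const 0)) (Assign aPen (Var vI) (Var vBig))"
  fix i m'
  assume i: "i < nv" "m' vI 0 = i" and f: "\<And>a. a \<notin> insert vI (writes ?p) \<Longrightarrow> m' a = m a"
  show "run ?p m' 2 (\<lambda>m''. m'' aPen = (m' aPen)(i := penalty i))"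
    using i assms by (simp add: f penalty_def)
qed (use assms in simp_all)

definition dist_at :: "nat \<Rightarrow> nat" where
  "dist_at p = dist (p div nv div nv) (p div nv mod nv) (p mod nv)"

text \<open>Shifted by one: the minimiser behind layer k of the distances is
  \<open>hop (k - 1)\<close> and is stored in layer k.\<close>

definition hop_at :: "nat \<Rightarrow> nat" where
  "hop_at p = hop (p div nv div nv - 1) (p div nv mod nv) (p mod nv)"

lemma index_parts:
  assumes "u < nv" "v < nv"
  shows "((k * nv + u) * nv + v) div nv = k * nv + u" "((k * nv + u) * nv + v) mod nv = v"
    "(k * nv + u) div nv = k" "(k * nv + u) mod nv = u"
  using assms by simp_all

text \<open>Row numbers \<open>k * nv + u\<close> must also lie inside the tables, since they are
  multiplied and reduced by lookup themselves.\<close>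

lemma index_less:
  assumes "u < nv" "v < nv" "k \<le> nv"
  shows "(k * nv + u) * nv + v < nv * nv + nv * (nv * nv)" "k * nv + u < nv * nv + nv * (nv * nv)"
proof -
  have "k * nv \<le> nv * nv" using assms(3) by (rule mult_right_mono) simp
  then have q: "Suc (k * nv + u) \<le> nv + nv * nv" using assms(1) by linarith
  have "(k * nv + u) * nv + v < Suc (k * nv + u) * nv" using assms(2) by simp
  also have "\<dots> \<le> (nv + nv * nv) * nv" using q by (rule mult_right_mono) simp
  also have "\<dots> = nv * nv + nv * (nv * nv)" by (simp add: algebra_simps)
  finally show less: "(k * nv + u) * nv + v < nv * nv + nv * (nv * nv)" .
  have "k * nv + u \<le> (k * nv + u) * nv" using nv_pos by simp
  then show "k * nv + u < nv * nv + nv * (nv * nv)" using less by linarith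
qed

text \<open>Increasing index order is a dynamic program: the entries of layer k - 1 all precede
  those of layer k. One entry costs a minimum over \<open>nv\<close> candidates.\<close>

lemma run_dist_table:
  assumes c: "costed m"
  shows "run dist_table m ((nv * nv + nv * (nv * nv)) * (nv * 5 + 10) + 2) (\<lambda>m'.
    \<forall>p < nv * nv + nv * (nv * nv). m' aDist p = dist_at p \<and> (nv * nv \<le> p \<longrightarrow> m' aHop p = hop_at p))"
  unfolding dist_table_def
proof (rule run_For[where N = "nv * nv + nv * (nv * nv)" and T = "nv * 5 + 8"
      and J = "\<lambda>i m'. \<forall>p < i. m' aDist p = dist_at p \<and> (nv * nv \<le> p \<longrightarrow> m' aHop p = hop_at p)"])
  let ?L = "nv * nv + nv * (nv * nv)"
  have m: "m vL 0 = ?L" "m vN2 0 = nv * nv" "m 0 0 = nv" "m vBig 0 = big"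
    "\<And>p. p < ?L \<Longrightarrow> m aRow p = p * nv \<and> m aMod p = p mod nv \<and> m aDiv p = p div nv"
    "\<And>p. p < nv * nv \<Longrightarrow> m aCost p = cost (p div nv) (p mod nv)"
    using c by (simp_all add: costed_def indexed_def sized_def)
  show "expr_val m (Var vL) = ?L" using m by simp
  let ?a = "Argmin vW vArg vMin nE hop_cost"
  let ?p = "If (Less (Var vI) (Var vN2))
      (If (Equal (Cell aDiv (Var vI)) (Cell aMod (Var vI))) (Assign aDist (Var vI) (Const 0))
        (Assign aDist (Var vI) (Var vBig)))
      (?a ;; Assign aDist (Var vI) (Var vMin) ;; Assign aHop (Var vI) (Var vArg))"
  fix i m'
  assume i: "i < ?L" and J: "\<forall>p < i. m' aDist p = dist_at p \<and> (nv * nv \<le> p \<longrightarrow> m' aHop p = hop_at p)"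
    and x: "m' vI 0 = i" and f: "\<And>a. a \<notin> insert vI (writes ?p) \<Longrightarrow> m' a = m a"
  let ?J = "\<lambda>m''. \<forall>p < Suc i. (m''(vI := (m'' vI)(0 := Suc i))) aDist p = dist_at p \<and>
    (nv * nv \<le> p \<longrightarrow> (m''(vI := (m'' vI)(0 := Suc i))) aHop p = hop_at p)"
  define v where "v = i mod nv"
  define u where "u = i div nv mod nv"
  define k where "k = i div nv div nv"
  have uv: "u < nv" "v < nv" using nv_pos by (simp_all add: u_def v_def)
  have q: "i div nv = k * nv + u" and ii: "i = (k * nv + u) * nv + v"
    by (simp_all add: u_def k_def v_def)
  have k: "k \<le> nv"
  proof (rule ccontr)
    assume "\<not> k \<le> nv"
    then have "Suc nv * nv \<le> k * nv" by (intro mult_right_mono) simp_all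
    then have "(Suc nv * nv) * nv \<le> (k * nv + u) * nv" by (intro mult_right_mono) simp_all
    then show False using i ii by (simp add: algebra_simps)
  qed
  show "run ?p m' (nv * 5 + 8) ?J"
  proof (cases "i < nv * nv")
    case True
    have "k = 0"
    proof (rule ccontr)
      assume "k \<noteq> 0"
      then have "1 * nv \<le> k * nv" by (intro mult_right_mono) simp_all
      then have "nv \<le> k * nv + u" by linarith
      then have "nv * nv \<le> (k * nv + u) * nv" by (rule mult_right_mono) simp
      then show False using True ii by linarith
    qed
    then have "dist_at i = (if u = v then 0 else big)" by (simp add: dist_at_def flip: k_def u_def v_def)
    moreover have "m aDiv i = u" "m aMod i = v" using m(5)[OF i] q \<open>k = 0\<close> by (simp_all add: v_def)
    ultimately show ?thesis using True x m J by (simp add: f less_Suc_eq)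
  next
    case False
    have "k \<noteq> 0"
    proof
      assume "k = 0"
      then have "i < Suc u * nv" using ii uv by simp
      also have "\<dots> \<le> nv * nv" using uv by (intro mult_right_mono) simp_all
      finally show False using False by simp
    qed
    then obtain k' where k': "k = Suc k'" by (cases k) auto
    let ?f = "\<lambda>w. cost u w + dist k' w v"
    have iL: "i div nv < ?L" using index_less(2)[OF uv k] q by simp
    have md: "m aDiv i = i div nv" "m aMod i = v" "m aMod (i div nv) = u"
      using m(5)[OF i] m(5)[OF iL] by (simp_all add: v_def u_def)
    have "run ?a m' (nv * 5 + 5) (\<lambda>m'. m' vArg 0 = argmin ?f nv \<and> m' vMin 0 = ?f (argmin ?f nv))"
    proof (rule run_Argmin)
      show "expr_val m' nE = nv" "0 < nv" using m nv_pos by (simp_all add: f)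
      fix w m1
      assume w: "w < nv" "m1 vW 0 = w" and f1: "\<And>a. a \<notin> {vW, vArg, vMin} \<Longrightarrow> m1 a = m' a"
      have w1: "u * nv + w < nv * nv"
      proof -
        have "u * nv + w < Suc u * nv" using w by simp
        also have "\<dots> \<le> nv * nv" using uv by (intro mult_right_mono) simp_all
        finally show ?thesis .
      qed
      have rows: "m aRow u = u * nv" "m aRow (k' * nv + w) = (k' * nv + w) * nv"
        using m(5) index_less(2)[of u 0 0] index_less(2)[of w 0 k'] uv nv_pos w k k' by simp_all
      have "m aCost (u * nv + w) = cost u w"
        using m(6)[OF w1] index_parts(3,4)[of w w u] w by simp
      moreover have "(k' * nv + w) * nv + v < i"
      proof -
        have "k' * nv + w < k * nv + u" using w k' by simp
        then have "Suc (k' * nv + w) * nv \<le> (k * nv + u) * nv" by (intro mult_right_mono) simp_all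
        then have "(k' * nv + w) * nv + nv \<le> (k * nv + u) * nv" by simp
        then show ?thesis using uv ii by linarith
      qed
      then have "m' aDist ((k' * nv + w) * nv + v) = dist k' w v"
        using J index_parts[OF w(1) uv(2), of k'] by (simp add: dist_at_def)
      moreover have "i div nv - u - nv = k' * nv" using q k' by simp
      ultimately show "expr_val m1 hop_cost = ?f w"
        using w x md rows m(3) by (simp add: hop_cost_def f1 f)
    qed simp_all
    then have r: "run (?a ;; Assign aDist (Var vI) (Var vMin) ;; Assign aHop (Var vI) (Var vArg)) m' (nv * 5 + 7) ?J"
    proof (rule run_Seq)
      fix m1 assume 1: "m1 vArg 0 = argmin ?f nv \<and> m1 vMin 0 = ?f (argmin ?f nv)"
        "\<And>a. a \<notin> writes ?a \<Longrightarrow> m1 a = m' a"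
      have "dist_at i = ?f (argmin ?f nv)" "hop_at i = argmin ?f nv"
        using k' by (simp_all add: dist_at_def hop_at_def hop_def Let_def flip: k_def u_def v_def)
      then show "run (Assign aDist (Var vI) (Var vMin) ;; Assign aHop (Var vI) (Var vArg)) m1 2 ?J"
        using 1 J x by (simp add: less_Suc_eq)
    qed simp
    have "run (?a ;; Assign aDist (Var vI) (Var vMin) ;; Assign aHop (Var vI) (Var vArg)) m' (nv * 5 + 8 - 1) ?J"
      by (rule run_weaken[OF r]) simp_all
    then show ?thesis using False x m unfolding run_If by (simp add: f)
  qed
qed (simp_all add: hop_cost_def)

end

section \<open>Word tables\<close>

abbreviation (input) "aClient \<equiv> 26 :: nat"
abbreviation (input) "vLetters \<equiv> 27 :: nat"
abbreviation (input) "vC \<equiv> 28 :: nat"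
abbreviation (input) "vPow \<equiv> 29 :: nat"
abbreviation (input) "vAcc \<equiv> 30 :: nat"
abbreviation (input) "aMod2 \<equiv> 31 :: nat"
abbreviation (input) "aDiv2 \<equiv> 32 :: nat"

definition collect :: prog where
  "collect = For vI nE (If (Equal (Cell 2 (Var vI)) (Const 1)) (Push aClient vLetters (Var vI)) Skip)"

text \<open>The second call of \<open>collect\<close> appends the second copy of the clients; the
  count in between is the number of clients.\<close>

definition letters :: prog where
  "letters = vLetters ::= Const 0 ;; collect ;; vC ::= Var vLetters ;; collect"

text \<open>The separate accumulator is essential: \<open>Times\<close> reads its summand in every
  round, so it must not add \<open>vPow\<close> to itself.\<close>

definition word_count :: prog where
  "word_count = vPow ::= Const 1 ;;
    For vI (Var vC) (vAcc ::= Const 0 ;; Times vAcc vJ (Var vLetters) (Var vPow) ;; vPow ::= Var vAcc)"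

definition word_tables :: prog where
  "word_tables = Mod_Table aMod2 vI (Var vLetters) (Var vPow) ;; Div_Table aDiv2 aMod2 vI (Var vPow)"

definition setup_tables :: prog where
  "setup_tables = sizes ;; index_tables ;; infinity ;; cost_table ;; penalty_table ;; dist_table ;;
    letters ;; word_count ;; word_tables"

lemma writes_setup [simp]:
  "writes collect = {aClient, vLetters, vI}" "writes letters = {aClient, vLetters, vI, vC}"
  "writes word_count = {vPow, vI, vAcc, vJ}" "writes word_tables = {aMod2, aDiv2, vI}"
  by (auto simp: collect_def letters_def word_count_def word_tables_def)

section \<open>Contents and correctness of the word tables\<close>

context vrp
begin

text \<open>The tables are described through the nested lookups that the programs perform, so that
  later proofs are free of index arithmetic.\<close>

definition ready :: "mem \<Rightarrow> bool" where
  "ready m \<longleftrightarrow> input m \<and> m vBig 0 = big \<and> (\<forall>d < nv. m aPen d = penalty d) \<and>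
    (\<forall>u < nv. \<forall>v < nv. m aDist (m aRow (m aRow nv + u) + v) = dist nv u v) \<and>
    (\<forall>k < nv. \<forall>u < nv. \<forall>v < nv. m aHop (m aRow (m aRow (Suc k) + u) + v) = hop k u v)"

definition tables :: "mem \<Rightarrow> bool" where
  "tables m \<longleftrightarrow> ready m \<and> m vC 0 = nc \<and> m vLetters 0 = nc + nc \<and> (\<forall>d < nc + nc. m aClient d = client d) \<and>
    m vPow 0 = (nc + nc) ^ nc \<and>
    (\<forall>t < (nc + nc) ^ nc. m aMod2 t = t mod (nc + nc) \<and> m aDiv2 t = t div (nc + nc))"

lemma ready_frame:
  assumes "ready m" "\<And>a. a \<in> {0, 1, 2, 3, 4, 5, vBig, aRow, aPen, aDist, aHop} \<Longrightarrow> m' a = m a"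
  shows "ready m'"
proof -
  have "input m'"
    using assms by (intro input_frame[of m m']) (auto simp: ready_def numeral_eq_Suc less_Suc_eq)
  then show ?thesis using assms unfolding ready_def by simp
qed

lemma tables_frame:
  assumes "tables m" "\<And>a. a \<in> {0, 1, 2, 3, 4, 5, vBig, aRow, aPen, aDist, aHop,
    aClient, vLetters, vC, vPow, aMod2, aDiv2} \<Longrightarrow> m' a = m a"
  shows "tables m'"
proof -
  have "ready m'"
    using assms by (intro ready_frame[of m m']) (auto simp: tables_def)
  then show ?thesis using assms unfolding tables_def by simp
qed

lemma run_ready:
  assumes "costed m"
  shows "run dist_table m ((nv * nv + nv * (nv * nv)) * (nv * 5 + 10) + 2) ready"
proof (rule run_weaken[OF run_dist_table[OF assms]])
  let ?L = "nv * nv + nv * (nv * nv)"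
  fix m'
  assume D: "\<forall>p < ?L. m' aDist p = dist_at p \<and> (nv * nv \<le> p \<longrightarrow> m' aHop p = hop_at p)"
    and f: "\<And>a. a \<notin> writes dist_table \<Longrightarrow> m' a = m a"
  have r: "m' aRow (m' aRow k + u) = (k * nv + u) * nv" if "u < nv" "k \<le> nv" for k u
  proof -
    have "k * nv + 0 < ?L" using index_less(2)[of 0 0 k] that nv_pos by simp
    moreover have "k \<le> k * nv" using nv_pos by simp
    ultimately have "k < ?L" by linarith
    moreover have "k * nv + u < ?L" using index_less(2)[of u u k] that by simp
    ultimately show ?thesis using assms by (simp add: f costed_def indexed_def)
  qed
  have i: "input m'" using assms by (intro input_frame[of m m']) (auto simp: f costed_def indexed_def sized_def)
  have d: "m' aDist (m' aRow (m' aRow nv + u) + v) = dist nv u v" if "u < nv" "v < nv" for u v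
    using D index_less(1)[of u v nv] index_parts[of u v nv] that r[of u nv] by (simp add: dist_at_def)
  have h: "m' aHop (m' aRow (m' aRow (Suc k) + u) + v) = hop k u v" if "u < nv" "v < nv" "k < nv" for u v k
  proof -
    have "nv \<le> Suc k * nv + u" by simp
    then have "nv * nv \<le> (Suc k * nv + u) * nv" by (rule mult_right_mono) simp
    then have "nv * nv \<le> (Suc k * nv + u) * nv + v" by (rule trans_le_add1)
    then show ?thesis
      using D index_less(1)[of u v "Suc k"] index_parts[of u v "Suc k"] that r[of u "Suc k"]
      by (simp add: hop_at_def del: mult_Suc)
  qed
  show "ready m'" unfolding ready_def using i d h assms by (simp add: f costed_def)
qed simp

text \<open>The prefix \<open>xs\<close> makes one statement serve both calls, from the empty list
  and from the first copy.\<close>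

lemma run_collect:
  assumes "input m" "holds m aClient vLetters xs"
  shows "run collect m (nv * 5 + 2) (\<lambda>m'. holds m' aClient vLetters (xs @ clist))"
  unfolding collect_def
proof (rule run_For[where N = nv and T = 3 and
    J = "\<lambda>i m'. holds m' aClient vLetters (xs @ filter (\<lambda>v. v \<in> clients I) [0..<i])"])
  let ?p = "If (Equal (Cell 2 (Var vI)) (Const 1)) (Push aClient vLetters (Var vI)) Skip"
  fix i m'
  let ?xs = "\<lambda>i. xs @ filter (\<lambda>v. v \<in> clients I) [0..<i]"
  assume i: "i < nv" "m' vI 0 = i" and h: "holds m' aClient vLetters (?xs i)"
    and f: "\<And>a. a \<notin> insert vI (writes ?p) \<Longrightarrow> m' a = m a"
  let ?Q = "\<lambda>m''. holds (m''(vI := (m'' vI)(0 := Suc i))) aClient vLetters (?xs (Suc i))"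
  show "run ?p m' 3 ?Q"
  proof (cases "i \<in> clients I")
    case True
    have "run (Push aClient vLetters (Var vI)) m' 2 ?Q"
      by (rule run_weaken[OF run_Push[OF h, where v = i]]) (use i True in \<open>simp_all add: holds_def\<close>)
    then show ?thesis using True i assms(1) by (simp add: f)
  next
    case False
    then show ?thesis using i assms(1) h by (simp add: f holds_def)
  qed
qed (use assms in \<open>simp_all add: holds_def clist_def\<close>)

lemma run_letters:
  assumes "input m"
  shows "run letters m (nv * 10 + 6)
    (\<lambda>m'. m' vC 0 = nc \<and> m' vLetters 0 = nc + nc \<and> (\<forall>d < nc + nc. m' aClient d = client d))"
    (is "run letters m _ ?Q")
proof -
  let ?m = "m(vLetters := (m vLetters)(0 := 0))"
  have "run (collect ;; vC ::= Var vLetters ;; collect) ?m (nv * 10 + 5) ?Q"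
  proof (rule run_Seq)
    show "run collect ?m (nv * 5 + 2) (\<lambda>m'. holds m' aClient vLetters ([] @ clist))"
      by (rule run_collect) (use assms in \<open>simp_all add: input_def holds_def\<close>)
  next
    fix m1 assume 1: "holds m1 aClient vLetters ([] @ clist)" "\<And>a. a \<notin> writes collect \<Longrightarrow> m1 a = ?m a"
    let ?m1 = "m1(vC := (m1 vC)(0 := nc))"
    have "run collect ?m1 (nv * 5 + 2) (\<lambda>m'. holds m' aClient vLetters (clist @ clist))"
      by (rule run_collect) (use assms 1 in \<open>simp_all add: input_def holds_def\<close>)
    then have "run collect ?m1 (nv * 5 + 2) ?Q"
      by (rule run_weaken) (simp_all add: holds_def nc_def client_def)
    moreover have "m1 vLetters 0 = nc" using 1(1) by (simp add: holds_def nc_def)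
    ultimately show "run (vC ::= Var vLetters ;; collect) m1 (nv * 5 + 3) ?Q" by simp
  qed simp
  from run_weaken[OF this] show ?thesis unfolding letters_def by simp
qed

lemma run_word_count:
  assumes "m vC 0 = nc" "m vLetters 0 = nc + nc"
  shows "run word_count m (nc * ((nc + nc) * 3 + 6) + 3) (\<lambda>m'. m' vPow 0 = (nc + nc) ^ nc)"
proof -
  let ?t = "Times vAcc vJ (Var vLetters) (Var vPow)"
  let ?p = "vAcc ::= Const 0 ;; ?t ;; vPow ::= Var vAcc"
  let ?m = "m(vPow := (m vPow)(0 := 1))"
  have "run (For vI (Var vC) ?p) ?m (nc * ((nc + nc) * 3 + 6) + 2) (\<lambda>m'. m' vPow 0 = (nc + nc) ^ nc)"
  proof (rule run_For[where N = nc and T = "(nc + nc) * 3 + 4" and J = "\<lambda>i m'. m' vPow 0 = (nc + nc) ^ i"])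
    fix i m'
    assume i: "m' vPow 0 = (nc + nc) ^ i" "m' vI 0 = i" and f: "\<And>a. a \<notin> insert vI (writes ?p) \<Longrightarrow> m' a = ?m a"
    let ?m' = "m'(vAcc := (m' vAcc)(0 := 0))"
    let ?Q = "\<lambda>m''. (m''(vI := (m'' vI)(0 := Suc i))) vPow 0 = (nc + nc) ^ Suc i"
    have "run (?t ;; vPow ::= Var vAcc) ?m' ((nc + nc) * 3 + 3) ?Q"
    proof (rule run_Seq[where T' = 1])
      show "run ?t ?m' ((nc + nc) * 3 + 2) (\<lambda>m''. m'' vAcc 0 = ?m' vAcc 0 + (nc + nc) * (nc + nc) ^ i)"
        by (rule run_Times) (use assms i in \<open>simp_all add: f\<close>)
    qed (simp_all add: algebra_simps)
    from run_weaken[OF this] show "run ?p m' ((nc + nc) * 3 + 4) ?Q" by simp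
  qed (use assms in simp_all)
  from run_weaken[OF this] show ?thesis unfolding word_count_def by simp
qed

lemma run_word_tables:
  assumes "m vLetters 0 = nc + nc" "m vPow 0 = (nc + nc) ^ nc"
  shows "run word_tables m ((nc + nc) ^ nc * 10 + 4)
    (\<lambda>m'. \<forall>t < (nc + nc) ^ nc. m' aMod2 t = t mod (nc + nc) \<and> m' aDiv2 t = t div (nc + nc))"
  unfolding word_tables_def
proof (rule run_Seq)
  show "run (Mod_Table aMod2 vI (Var vLetters) (Var vPow)) m ((nc + nc) ^ nc * 5 + 2)
      (\<lambda>m'. \<forall>t < (nc + nc) ^ nc. m' aMod2 t = t mod (nc + nc))"
    by (rule run_Mod_Table) (use assms in simp_all)
next
  fix m1 assume 1: "\<forall>t < (nc + nc) ^ nc. m1 aMod2 t = t mod (nc + nc)"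
    "\<And>a. a \<notin> writes (Mod_Table aMod2 vI (Var vLetters) (Var vPow)) \<Longrightarrow> m1 a = m a"
  have "run (Div_Table aDiv2 aMod2 vI (Var vPow)) m1 ((nc + nc) ^ nc * 5 + 2)
      (\<lambda>m'. \<forall>t < (nc + nc) ^ nc. m' aDiv2 t = t div (nc + nc))"
    by (rule run_Div_Table) (use assms 1 in simp_all)
  then show "run (Div_Table aDiv2 aMod2 vI (Var vPow)) m1 ((nc + nc) ^ nc * 5 + 2)
      (\<lambda>m'. \<forall>t < (nc + nc) ^ nc. m' aMod2 t = t mod (nc + nc) \<and> m' aDiv2 t = t div (nc + nc))"
    by (rule run_weaken) (use 1 in simp_all)
qed simp

definition setup_time :: nat where
  "setup_time = (nv * 6 + 6) + ((nv * nv + nv * (nv * nv)) * 14 + 6) + (nv * nv * 6 + 6) +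
    (nv * nv * 5 + 2) + (nv * 4 + 2) + ((nv * nv + nv * (nv * nv)) * (nv * 5 + 10) + 2) +
    (nv * 10 + 6) + (nc * ((nc + nc) * 3 + 6) + 3) + ((nc + nc) ^ nc * 10 + 4)"

text \<open>Assembled from the last phase to the first, since \<open>run_Seq\<close> asks for the
  rest of the program to run correctly from every memory that meets the intermediate
  assertion.\<close>

lemma run_setup_tables:
  assumes "input m"
  shows "run setup_tables m setup_time tables"
proof -
  have 9: "run word_tables m ((nc + nc) ^ nc * 10 + 4) tables"
    if m: "ready m" "m vC 0 = nc" "m vLetters 0 = nc + nc" "\<forall>d < nc + nc. m aClient d = client d"
      "m vPow 0 = (nc + nc) ^ nc" for m
  proof (rule run_weaken[OF run_word_tables])
    fix m' assume *: "\<forall>t < (nc + nc) ^ nc. m' aMod2 t = t mod (nc + nc) \<and> m' aDiv2 t = t div (nc + nc)"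
      and f: "\<And>a. a \<notin> writes word_tables \<Longrightarrow> m' a = m a"
    have "ready m'" by (rule ready_frame[OF m(1)]) (auto simp: f)
    then show "tables m'" using m * by (simp add: tables_def f)
  qed (use m in simp_all)
  have 8: "run (word_count ;; word_tables) m ((nc * ((nc + nc) * 3 + 6) + 3) + ((nc + nc) ^ nc * 10 + 4)) tables"
    if m: "ready m" "m vC 0 = nc" "m vLetters 0 = nc + nc" "\<forall>d < nc + nc. m aClient d = client d" for m
  proof (rule run_Seq[OF run_word_count 9])
    fix m' assume f: "\<And>a. a \<notin> writes word_count \<Longrightarrow> m' a = m a"
    show "ready m'" by (rule ready_frame[OF m(1)]) (auto simp: f)
    show "m' vC 0 = nc" "m' vLetters 0 = nc + nc" "\<forall>d < nc + nc. m' aClient d = client d"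
      using m by (simp_all add: f)
  qed (use m in simp_all)
  have 7: "run (letters ;; word_count ;; word_tables) m ((nv * 10 + 6) +
      ((nc * ((nc + nc) * 3 + 6) + 3) + ((nc + nc) ^ nc * 10 + 4))) tables" if m: "ready m" for m
  proof (rule run_Seq[OF run_letters 8])
    fix m' assume f: "\<And>a. a \<notin> writes letters \<Longrightarrow> m' a = m a"
    show "ready m'" by (rule ready_frame[OF m(1)]) (auto simp: f)
  qed (use m in \<open>simp_all add: ready_def\<close>)
  let ?t7 = "(nv * 10 + 6) + ((nc * ((nc + nc) * 3 + 6) + 3) + ((nc + nc) ^ nc * 10 + 4))"
  let ?t6 = "((nv * nv + nv * (nv * nv)) * (nv * 5 + 10) + 2) + ?t7"
  have 6: "run (dist_table ;; letters ;; word_count ;; word_tables) m ?t6 tables" if "costed m" for m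
    by (rule run_Seq[OF run_ready 7]) (use that in simp_all)
  have 5: "run (penalty_table ;; dist_table ;; letters ;; word_count ;; word_tables) m
      ((nv * 4 + 2) + ?t6) tables"
    if m: "indexed m" "m vBig 0 = big" "\<forall>p < nv * nv. m aCost p = cost (p div nv) (p mod nv)" for m
  proof (rule run_Seq[OF run_penalty_table 6])
    fix m' assume "\<forall>d < nv. m' aPen d = penalty d" and f: "\<And>a. a \<notin> writes penalty_table \<Longrightarrow> m' a = m a"
    then show "costed m'" using m by (simp add: costed_def indexed_def sized_def input_def)
  qed (use m in \<open>simp_all add: indexed_def sized_def\<close>)
  have 4: "run (cost_table ;; penalty_table ;; dist_table ;; letters ;; word_count ;; word_tables) m
      ((nv * nv * 5 + 2) + ((nv * 4 + 2) + ?t6)) tables"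
    if m: "indexed m" "m vBig 0 = big" for m
  proof (rule run_Seq[OF run_cost_table 5])
    fix m' assume f: "\<And>a. a \<notin> writes cost_table \<Longrightarrow> m' a = m a"
    then show "indexed m'" "m' vBig 0 = big" using m by (simp_all add: indexed_def sized_def input_def)
  qed (use m in simp_all)
  have 3: "run (infinity ;; cost_table ;; penalty_table ;; dist_table ;; letters ;; word_count ;; word_tables) m
      ((nv * nv * 6 + 6) + ((nv * nv * 5 + 2) + ((nv * 4 + 2) + ?t6))) tables"
    if m: "indexed m" for m
  proof (rule run_Seq[OF run_infinity 4])
    fix m' assume f: "\<And>a. a \<notin> writes infinity \<Longrightarrow> m' a = m a"
    then show "indexed m'" using m by (simp add: indexed_def sized_def input_def)
  qed (use m in simp_all)
  have 2: "run (index_tables ;; infinity ;; cost_table ;; penalty_table ;; dist_table ;; letters ;;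
      word_count ;; word_tables) m (((nv * nv + nv * (nv * nv)) * 14 + 6) +
        ((nv * nv * 6 + 6) + ((nv * nv * 5 + 2) + ((nv * 4 + 2) + ?t6)))) tables"
    if m: "sized m" for m
    by (rule run_Seq[OF run_index_tables 3]) (use m in simp_all)
  show ?thesis
    unfolding setup_tables_def setup_time_def
    by (rule run_Seq[OF run_sizes[OF assms] 2]) simp_all
qed

end

section \<open>Evaluating words\<close>

abbreviation (input) "vT \<equiv> 33 :: nat"
abbreviation (input) "aWord \<equiv> 34 :: nat"
abbreviation (input) "aPos \<equiv> 35 :: nat"
abbreviation (input) "vX \<equiv> 36 :: nat"
abbreviation (input) "vFresh \<equiv> 37 :: nat"
abbreviation (input) "vSeg \<equiv> 38 :: nat"
abbreviation (input) "vTot \<equiv> 39 :: nat"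
abbreviation (input) "vOk \<equiv> 40 :: nat"
abbreviation (input) "vFirst \<equiv> 41 :: nat"
abbreviation (input) "vLast \<equiv> 42 :: nat"
abbreviation (input) "vPath \<equiv> 43 :: nat"
abbreviation (input) "vLoad \<equiv> 44 :: nat"
abbreviation (input) "vV \<equiv> 45 :: nat"
abbreviation (input) "aBase \<equiv> 46 :: nat"
abbreviation (input) "vBest \<equiv> 47 :: nat"
abbreviation (input) "vBestT \<equiv> 48 :: nat"

text \<open>A client occurs only once in a word if the position noted for it, which is that of its
  last occurrence, agrees with the position of every occurrence.\<close>

definition read_word :: prog where
  "read_word = vX ::= Var vT ;; For vI (Var vC)
    (Assign aWord (Var vI) (Cell aMod2 (Var vX)) ;;
     Assign aPos (Cell aClient (Cell aWord (Var vI))) (Var vI) ;;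
     vX ::= Cell aDiv2 (Var vX))"

text \<open>Array 9 is already the assignment of the output. Every word overwrites it, so the best
  word has to be evaluated once more at the end.\<close>

definition visit :: prog where
  "visit = vV ::= Cell aClient (Cell aWord (Var vI)) ;;
    If (Equal (Var vFresh) (Const 1))
      (vFirst ::= Var vV ;; vPath ::= Const 0 ;; vLoad ::= Const 0 ;; vFresh ::= Const 0)
      (vPath ::= Plus (Var vPath) (Dist (Plus (Cell aRow nE) (Var vLast)) (Var vV))) ;;
    vLast ::= Var vV ;; vLoad ::= Plus (Var vLoad) (Cell 3 (Var vV)) ;; Assign 9 (Var vV) (Var vSeg) ;;
    If (Equal (Cell aPos (Var vV)) (Var vI)) Skip (vOk ::= Const 0)"

definition depot_cost :: expr where
  "depot_cost = Plus (Plus (Dist (Plus (Cell aRow nE) (Var vW)) (Var vFirst))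
    (Dist (Plus (Cell aRow nE) (Var vLast)) (Var vW))) (Cell aPen (Var vW))"

text \<open>The flag \<open>g\<close> tells whether the gas capacity is to be respected. Without a load constraint
  all demands and the capacity read 0 in memory, so that the load test needs no flag.\<close>

definition finish :: "nat \<Rightarrow> prog" where
  "finish g = Argmin vW vArg vMin nE depot_cost ;;
    Assign aBase (Var vSeg) (Var vArg) ;; vPath ::= Plus (Var vPath) (Var vMin) ;;
    If (Less (Cell 0 (Const 2)) (Var vLoad)) (vOk ::= Const 0) Skip ;;
    If (Conj (Equal (Const g) (Const 1)) (Less (Cell 0 (Const 3)) (Var vPath))) (vOk ::= Const 0) Skip ;;
    vTot ::= Plus (Var vTot) (Var vPath) ;; vSeg ::= Plus (Var vSeg) (Const 1) ;; vFresh ::= Const 1"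

definition scan_letter :: "nat \<Rightarrow> prog" where
  "scan_letter g = visit ;; If (Less (Cell aWord (Var vI)) (Var vC)) Skip (finish g)"

definition scan :: "nat \<Rightarrow> prog" where
  "scan g = vFresh ::= Const 1 ;; vSeg ::= Const 0 ;; vTot ::= Const 0 ;; vOk ::= Const 1 ;;
    For vI (Var vC) (scan_letter g) ;;
    If (Equal (Var vFresh) (Const 1)) Skip (vOk ::= Const 0) ;;
    If (Less (Cell 0 (Const 1)) (Var vSeg)) (vOk ::= Const 0) Skip"

definition evaluate :: "nat \<Rightarrow> prog" where
  "evaluate g = read_word ;; scan g"

text \<open>With \<open>vBig\<close> as the initial value and a strict comparison,
  \<open>vBest\<close> stays at infinity exactly when no valid word is cheaper than
  infinity.\<close>

definition search :: "nat \<Rightarrow> prog" where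
  "search g = vBest ::= Var vBig ;; vBestT ::= Const 0 ;; For vT (Var vPow)
    (evaluate g ;; If (Conj (Equal (Var vOk) (Const 1)) (Less (Var vTot) (Var vBest)))
      (vBest ::= Var vTot ;; vBestT ::= Var vT) Skip)"

lemma writes_read_word [simp]: "writes read_word = {vX, vI, aWord, aPos}"
  unfolding read_word_def by (rule equalityI) simp_all

lemma writes_visit [simp]: "writes visit = {vV, vFirst, vPath, vLoad, vFresh, vLast, 9, vOk}"
  unfolding visit_def by (rule equalityI) simp_all

lemma writes_finish [simp]:
  "writes (finish g) = {vW, vArg, vMin, aBase, vPath, vOk, vTot, vSeg, vFresh}"
  unfolding finish_def by (rule equalityI) simp_all

lemma writes_scan_letter [simp]:
  "writes (scan_letter g) =
    {vV, vFirst, vPath, vLoad, vFresh, vLast, 9, vOk, vW, vArg, vMin, aBase, vTot, vSeg}"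
  unfolding scan_letter_def by (rule equalityI) simp_all

lemma writes_scan [simp]:
  "writes (scan g) =
    {vI, vV, vFirst, vPath, vLoad, vFresh, vLast, 9, vOk, vW, vArg, vMin, aBase, vTot, vSeg}"
  unfolding scan_def by (rule equalityI) simp_all

lemma writes_evaluate [simp]:
  "writes (evaluate g) = {vX, aWord, aPos,
    vI, vV, vFirst, vPath, vLoad, vFresh, vLast, 9, vOk, vW, vArg, vMin, aBase, vTot, vSeg}"
  unfolding evaluate_def by (rule equalityI) simp_all

lemma writes_search [simp]:
  "writes (search g) = {vBest, vBestT, vT, vX, aWord, aPos,
    vI, vV, vFirst, vPath, vLoad, vFresh, vLast, 9, vOk, vW, vArg, vMin, aBase, vTot, vSeg}"
  unfolding search_def by (rule equalityI) simp_all

section \<open>Correctness of the search over words\<close>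

context vrp
begin

definition word_read :: "nat \<Rightarrow> mem \<Rightarrow> bool" where
  "word_read t m \<longleftrightarrow> (\<forall>i < nc. m aWord i = word t ! i) \<and>
    (distinct (map client (word t)) \<longleftrightarrow> (\<forall>i < nc. m aPos (client (word t ! i)) = i))"

lemma word_nth_less: "i < nc \<Longrightarrow> word t ! i < nc + nc"
  using word_less[of "word t ! i" t] by simp

lemma client_less: "d < nc + nc \<Longrightarrow> client d < nv"
proof -
  assume "d < nc + nc"
  then have "client d \<in> clients I" by (rule client_in)
  moreover have "clients I \<subseteq> verts I" using inst by (simp add: cvrp_instance_def)
  ultimately show "client d < nv" using verts_eq by blast
qed

lemma run_read_word:
  assumes "tables m" "m vT 0 = t" "t < (nc + nc) ^ nc"
  shows "run read_word m (nc * 5 + 3) (word_read t)"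
proof -
  let ?b = "nc + nc"
  let ?c = "\<lambda>i. client (word t ! i)"
  let ?p = "Assign aWord (Var vI) (Cell aMod2 (Var vX)) ;;
     Assign aPos (Cell aClient (Cell aWord (Var vI))) (Var vI) ;; vX ::= Cell aDiv2 (Var vX)"
  let ?m = "m(vX := (m vX)(0 := t))"
  \<comment> \<open>Positions are claimed only for distinct clients, because a repeated client
    overwrites its earlier position.\<close>
  let ?J = "\<lambda>i m'. m' vX 0 = t div ?b ^ i \<and> (\<forall>j < i. m' aWord j = word t ! j) \<and>
    (distinct (map client (word t)) \<longrightarrow> (\<forall>j < i. m' aPos (?c j) = j))"
  have "run (For vI (Var vC) ?p) ?m (nc * 5 + 2) (word_read t)"
  proof (rule run_For[where N = nc and T = 3 and J = ?J])
    show "expr_val ?m (Var vC) = nc" using assms by (simp add: tables_def)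
    fix i m'
    assume i: "i < nc" "?J i m'" "m' vI 0 = i" and f: "\<And>a. a \<notin> insert vI (writes ?p) \<Longrightarrow> m' a = ?m a"
    have x: "t div ?b ^ i < ?b ^ nc" using assms(3) by (meson div_le_dividend le_less_trans)
    then have "m aMod2 (t div ?b ^ i) = word t ! i" "m aDiv2 (t div ?b ^ i) = t div ?b ^ Suc i"
      using assms(1) i(1) by (simp_all add: tables_def word_def div_mult2_eq[symmetric] mult.commute)
    moreover have "m aClient (word t ! i) = ?c i" using assms(1) word_nth_less[OF i(1)] by (simp add: tables_def)
    moreover have "?c j \<noteq> ?c i" if "j < i" "distinct (map client (word t))" for j
      using that i(1) nth_eq_iff_index_eq[of "map client (word t)" j i] by simp
    ultimately show "run ?p m' 3 (\<lambda>m''. ?J (Suc i) (m''(vI := (m'' vI)(0 := Suc i))))"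
      using i by (auto simp: f less_Suc_eq)
  next
    fix m' assume J: "?J nc m'"
    \<comment> \<open>Conversely, equal clients at two places share one noted position, and if it
      agrees with both places, the places coincide.\<close>
    have "distinct (map client (word t))" if p: "\<forall>i < nc. m' aPos (?c i) = i"
      unfolding distinct_conv_nth using p by simp metis
    then show "word_read t m'" using J by (auto simp: word_read_def)
  qed simp_all
  from run_weaken[OF this] show ?thesis using assms(2) unfolding read_word_def by simp
qed

text \<open>\<open>P\<close> accumulates the outcome of all tests so far. The assignment is
  described only while no client has been repeated, since a repetition would spoil the entry for the
  earlier tour.\<close>

definition scanned :: "nat list list \<Rightarrow> nat list \<Rightarrow> bool \<Rightarrow> mem \<Rightarrow> bool" where
  "scanned ss s P m \<longleftrightarrow> m vFresh 0 = of_bool (s = []) \<and> m vSeg 0 = length ss \<and> m vTot 0 = plan_cost ss \<and>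
    m vOk 0 = of_bool P \<and> (\<forall>j < length ss. m aBase j = base (ss ! j)) \<and>
    (s \<noteq> [] \<longrightarrow> m vFirst 0 = hd s \<and> m vLast 0 = last s \<and> m vPath 0 = stops_cost s \<and>
      m vLoad 0 = sum_list (map demand s)) \<and>
    (distinct (concat ss @ s) \<longrightarrow>
      (\<forall>j < length ss. \<forall>v \<in> set (ss ! j). m 9 v = j) \<and> (\<forall>v \<in> set s. m 9 v = length ss))"

lemma run_visit:
  assumes "tables m" "scanned ss s P m" "m aWord (m vI 0) = d" "d < nc + nc" "\<And>v. v \<in> set s \<Longrightarrow> v < nv"
  shows "run visit m 11 (scanned ss (s @ [client d]) (P \<and> m aPos (client d) = m vI 0))"
proof -
  let ?v = "client d"
  have m: "m aClient d = ?v" "m 0 0 = nv" "m 3 ?v = demand ?v"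
    using assms by (simp_all add: tables_def ready_def)
  have 9: "(\<forall>j < length ss. \<forall>v \<in> set (ss ! j). ((m 9)(?v := length ss)) v = j) \<and>
      (\<forall>v \<in> set (s @ [?v]). ((m 9)(?v := length ss)) v = length ss)"
    if "distinct (concat ss @ s @ [?v])"
  proof -
    have "?v \<notin> set (ss ! j)" if "j < length ss" for j
      using \<open>distinct (concat ss @ s @ [?v])\<close> nth_mem[OF that] by auto
    then show ?thesis using that assms(2) by (auto simp: scanned_def)
  qed
  show ?thesis
  proof (cases "s = []")
    case True
    then show ?thesis
      using assms(2,3) m 9 by (simp add: visit_def scanned_def)
  next
    case False
    have "last s < nv" using False assms(5) by simp
    then have "m aDist (m aRow (m aRow nv + last s) + ?v) = dist nv (last s) ?v"
      using assms(1) client_less[OF assms(4)] by (simp add: tables_def ready_def)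
    then show ?thesis
      using False assms(2,3) m 9 by (simp add: visit_def scanned_def stops_cost_append)
  qed
qed

text \<open>The memory cell reads 0 both without a gas limit and for the limit 0, so the memory does
  not tell these apart and the program has to carry the flag.\<close>

definition gas_flag :: "nat \<Rightarrow> bool" where
  "gas_flag g \<longleftrightarrow> (if g = 1 then gas I = Some (input_mem I 0 3) else gas I = None)"

lemma run_finish:
  assumes "tables m" "scanned ss s P m" "s \<noteq> []" "\<And>v. v \<in> set s \<Longrightarrow> v < nv" and g: "gas_flag g"
  shows "run (finish g) m (nv * 5 + 14) (scanned (ss @ [s]) [] (P \<and> tour_ok s))"
proof -
  let ?f = "\<lambda>d. dist nv d (hd s) + dist nv (last s) d + penalty d"
  have b: "argmin ?f nv = base s" by (simp add: base_def depot_def)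
  have m: "m 0 0 = nv" "m 0 2 = input_mem I 0 2" "m 0 3 = input_mem I 0 3"
    using assms by (simp_all add: tables_def ready_def)
  have gas: "gas_ok x \<longleftrightarrow> \<not> (g = 1 \<and> input_mem I 0 3 < x)" for x
    using g unfolding gas_ok_def gas_flag_def by (cases "g = 1") (simp_all add: not_less)
  have s: "m vFirst 0 = hd s" "m vLast 0 = last s" "m vPath 0 = stops_cost s"
    "m vLoad 0 = sum_list (map demand s)"
    using assms(2,3) by (simp_all add: scanned_def)
  have tc: "stops_cost s + ?f (base s) = tour_cost s" by (simp add: tour_cost_def)
  show ?thesis
    unfolding finish_def
  proof (rule run_Seq[where T' = 9])
    show "run (Argmin vW vArg vMin nE depot_cost) m (nv * 5 + 5)
      (\<lambda>m'. m' vArg 0 = argmin ?f nv \<and> m' vMin 0 = ?f (argmin ?f nv))"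
    proof (rule run_Argmin)
      show "expr_val m nE = nv" using m by simp
      fix d m' assume d: "d < nv" "m' vW 0 = d" and f: "\<And>a. a \<notin> {vW, vArg, vMin} \<Longrightarrow> m' a = m a"
      have "hd s < nv" "last s < nv" using assms(3,4) by simp_all
      then show "expr_val m' depot_cost = ?f d"
        using d s m assms(1) by (simp add: depot_cost_def f tables_def ready_def)
    qed (simp_all add: nv_pos)
  next
    fix m1
    assume 1: "m1 vArg 0 = argmin ?f nv \<and> m1 vMin 0 = ?f (argmin ?f nv)"
      and f: "\<And>a. a \<notin> writes (Argmin vW vArg vMin nE depot_cost) \<Longrightarrow> m1 a = m a"
    have 1: "m1 vArg 0 = base s" "stops_cost s + m1 vMin 0 = tour_cost s" using 1 b tc by simp_all
    show "run (Assign aBase (Var vSeg) (Var vArg) ;; vPath ::= Plus (Var vPath) (Var vMin) ;;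
      If (Less (Cell 0 (Const 2)) (Var vLoad)) (vOk ::= Const 0) Skip ;;
      If (Conj (Equal (Const g) (Const 1)) (Less (Cell 0 (Const 3)) (Var vPath))) (vOk ::= Const 0) Skip ;;
      vTot ::= Plus (Var vTot) (Var vPath) ;; vSeg ::= Plus (Var vSeg) (Const 1) ;; vFresh ::= Const 1)
      m1 9 (scanned (ss @ [s]) [] (P \<and> tour_ok s))"
      using assms(2,3) s m 1 gas
      by (simp add: f scanned_def tour_ok_def plan_cost_def nth_append less_Suc_eq not_less)
  qed simp
qed

lemma run_scan_letter:
  assumes "tables m" "scanned ss s P m" "m aWord (m vI 0) = d" "d < nc + nc" "\<And>v. v \<in> set s \<Longrightarrow> v < nv"
    and g: "gas_flag g"
  shows "run (scan_letter g) m (nv * 5 + 26) (\<lambda>m'. let (ss', s') = decode_letter (ss, s) d in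
    scanned ss' s' (P \<and> m aPos (client d) = m vI 0 \<and> (nc \<le> d \<longrightarrow> tour_ok (s @ [client d]))) m')"
  unfolding scan_letter_def
proof (rule run_Seq[OF run_visit[OF assms(1-5)]])
  fix m1 assume 1: "scanned ss (s @ [client d]) (P \<and> m aPos (client d) = m vI 0) m1"
    and f: "\<And>a. a \<notin> writes visit \<Longrightarrow> m1 a = m a"
  let ?Q = "\<lambda>m'. let (ss', s') = decode_letter (ss, s) d in
    scanned ss' s' (P \<and> m aPos (client d) = m vI 0 \<and> (nc \<le> d \<longrightarrow> tour_ok (s @ [client d]))) m'"
  have t: "tables m1" by (rule tables_frame[OF assms(1)]) (auto simp: f)
  have c: "m1 aWord (m1 vI 0) = d" "m1 vC 0 = nc" using assms(1,3) by (simp_all add: f tables_def)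
  show "run (If (Less (Cell aWord (Var vI)) (Var vC)) Skip (finish g)) m1 (nv * 5 + 15) ?Q"
  proof (cases "d < nc")
    case True
    then show ?thesis using 1 c by (simp add: decode_letter_def)
  next
    case False
    have "run (finish g) m1 (nv * 5 + 15 - 1) ?Q"
    proof (rule run_weaken[OF run_finish[OF t 1 _ _ g]])
      show "v < nv" if "v \<in> set (s @ [client d])" for v using that assms(5) client_less[OF assms(4)] by auto
      fix m' assume "scanned (ss @ [s @ [client d]]) [] ((P \<and> m aPos (client d) = m vI 0) \<and> tour_ok (s @ [client d])) m'"
      then show "?Q m'" using False by (simp add: decode_letter_def)
    qed simp_all
    then show ?thesis using False c unfolding run_If by simp
  qed
next
  show "11 + (nv * 5 + 15) \<le> nv * 5 + 26" by simp
qed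

lemma decode_take:
  assumes "i < nc"
  shows "decode (take (Suc i) (word t)) = decode_letter (decode (take i (word t))) (word t ! i)"
  using assms by (simp add: take_Suc_conv_app_nth)

lemma run_scan:
  assumes tab: "tables m" and w: "word_read t m" and g: "gas_flag g"
  shows "run (scan g) m (nc * (nv * 5 + 28) + 12)
    (\<lambda>m'. m' vOk 0 = of_bool (valid t) \<and> m' vSeg 0 = length (tours_of t) \<and>
      m' vTot 0 = plan_cost (tours_of t) \<and>
      (\<forall>j < length (tours_of t). m' aBase j = base (tours_of t ! j)) \<and>
      (valid t \<longrightarrow> (\<forall>j < length (tours_of t). \<forall>v \<in> set (tours_of t ! j). m' 9 v = j)))"
    (is "run _ _ _ ?Q")
proof -
  let ?d = "\<lambda>i. decode (take i (word t))"
  let ?P = "\<lambda>i. (\<forall>j < i. m aPos (client (word t ! j)) = j) \<and> (\<forall>s \<in> set (fst (?d i)). tour_ok s)"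
  let ?J = "\<lambda>i m'. scanned (fst (?d i)) (snd (?d i)) (?P i) m'"
  let ?m = "m(vFresh := (m vFresh)(0 := 1), vSeg := (m vSeg)(0 := 0), vTot := (m vTot)(0 := 0),
    vOk := (m vOk)(0 := 1))"
  let ?q = "If (Equal (Var vFresh) (Const 1)) Skip (vOk ::= Const 0) ;;
    If (Less (Cell 0 (Const 1)) (Var vSeg)) (vOk ::= Const 0) Skip"
  have "run (For vI (Var vC) (scan_letter g) ;; ?q) ?m (nc * (nv * 5 + 28) + 8) ?Q"
  proof (rule run_Seq)
    show "run (For vI (Var vC) (scan_letter g)) ?m (nc * (nv * 5 + 28) + 2) (?J nc)"
    proof (rule run_For[where N = nc and T = "nv * 5 + 26" and J = ?J])
      show "expr_val ?m (Var vC) = nc" using tab by (simp add: tables_def)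
      show "?J 0 (?m(vI := (?m vI)(0 := 0)))" by (simp add: scanned_def plan_cost_def)
      fix i m'
      assume i: "i < nc" and J: "?J i m'" and x: "m' vI 0 = i"
        and f: "\<And>a. a \<notin> insert vI (writes (scan_letter g)) \<Longrightarrow> m' a = ?m a"
      have t: "tables m'" by (rule tables_frame[OF tab]) (auto simp: f)
      have d: "m' aWord (m' vI 0) = word t ! i" using w i x by (simp add: f word_read_def)
      have s: "v < nv" if "v \<in> set (snd (?d i))" for v
      proof -
        have "v \<in> set (map client (take i (word t)))"
          unfolding concat_decode[symmetric] using that by simp
        then obtain e where "e \<in> set (word t)" "v = client e" by (auto dest: in_set_takeD)
        then show ?thesis using client_less word_less by simp
      qed
      have "?P (Suc i) \<longleftrightarrow> ?P i \<and> m' aPos (client (word t ! i)) = m' vI 0 \<and>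
          (nc \<le> word t ! i \<longrightarrow> tour_ok (snd (?d i) @ [client (word t ! i)]))"
        using decode_take[OF i, of t] x by (auto simp: f less_Suc_eq decode_letter_def)
      then show "run (scan_letter g) m' (nv * 5 + 26) (\<lambda>m''. ?J (Suc i) (m''(vI := (m'' vI)(0 := Suc i))))"
        using decode_take[OF i, of t]
        by (intro run_weaken[OF run_scan_letter[OF t J d word_nth_less[OF i] s g]])
          (simp_all add: scanned_def split_beta Let_def)
    qed simp_all
  next
    fix m1 assume J: "?J nc m1" and f: "\<And>a. a \<notin> writes (For vI (Var vC) (scan_letter g)) \<Longrightarrow> m1 a = ?m a"
    have tk: "take nc (word t) = word t" by simp
    \<comment> \<open>The accumulated tests are those of \<open>plan_tours_of_iff\<close>, with
      agreement of positions standing for distinctness; the open tour and the number of vehicles are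
      checked after the loop.\<close>
    have v: "valid t \<longleftrightarrow> ?P nc \<and> snd (decode (word t)) = [] \<and> length (tours_of t) \<le> vehicles I"
      using w plan_tours_of_iff[of t] unfolding valid_def word_read_def tk tours_of_def by blast
    have k: "m1 0 (Suc 0) = vehicles I" using tab by (simp add: f tables_def ready_def)
    have c: "concat (tours_of t) @ snd (decode (word t)) = map client (word t)"
      unfolding tours_of_def by (rule concat_decode)
    have 9: "\<forall>j < length (tours_of t). \<forall>v \<in> set (tours_of t ! j). m1 9 v = j" if "valid t"
    proof -
      have "distinct (concat (tours_of t) @ snd (decode (word t)))"
        using that by (simp add: valid_def plan_def)
      then show ?thesis using J unfolding scanned_def tk tours_of_def by blast
    qed
    show "run ?q m1 6 ?Q"
      using J 9 k v unfolding tk scanned_def tours_of_def[symmetric] by (simp add: not_less)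
  qed simp
  from run_weaken[OF this] show ?thesis unfolding scan_def by simp
qed

text \<open>\<open>word_read\<close> is kept in the postcondition because the output phase reads the
  letters again.\<close>

lemma run_evaluate:
  assumes tab: "tables m" and t: "m vT 0 = t" "t < (nc + nc) ^ nc" and g: "gas_flag g"
  shows "run (evaluate g) m (nc * (nv * 5 + 33) + 15)
    (\<lambda>m'. word_read t m' \<and> m' vOk 0 = of_bool (valid t) \<and> m' vSeg 0 = length (tours_of t) \<and>
      m' vTot 0 = plan_cost (tours_of t) \<and>
      (\<forall>j < length (tours_of t). m' aBase j = base (tours_of t ! j)) \<and>
      (valid t \<longrightarrow> (\<forall>j < length (tours_of t). \<forall>v \<in> set (tours_of t ! j). m' 9 v = j)))"
  unfolding evaluate_def
proof (rule run_Seq[OF run_read_word[OF tab t]])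
  fix m1 assume w: "word_read t m1" and f: "\<And>a. a \<notin> writes read_word \<Longrightarrow> m1 a = m a"
  have tab1: "tables m1" by (rule tables_frame[OF tab]) (auto simp: f)
  show "run (scan g) m1 (nc * (nv * 5 + 28) + 12)
    (\<lambda>m'. word_read t m' \<and> m' vOk 0 = of_bool (valid t) \<and> m' vSeg 0 = length (tours_of t) \<and>
      m' vTot 0 = plan_cost (tours_of t) \<and>
      (\<forall>j < length (tours_of t). m' aBase j = base (tours_of t ! j)) \<and>
      (valid t \<longrightarrow> (\<forall>j < length (tours_of t). \<forall>v \<in> set (tours_of t ! j). m' 9 v = j)))"
    by (rule run_weaken[OF run_scan[OF tab1 w g]]) (use w in \<open>simp_all add: word_read_def\<close>)
qed (simp add: algebra_simps)

text \<open>\<open>vBestT\<close> has a meaning only once something below infinity has been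
  found.\<close>

definition best_below :: "nat \<Rightarrow> mem \<Rightarrow> bool" where
  "best_below i m \<longleftrightarrow> m vBest 0 \<le> big \<and> (\<forall>t < i. m vBest 0 \<le> score t) \<and>
    (m vBest 0 < big \<longrightarrow> m vBestT 0 < i \<and> score (m vBestT 0) = m vBest 0)"

lemma run_search:
  assumes tab: "tables m" and g: "gas_flag g"
  shows "run (search g) m ((nc + nc) ^ nc * (nc * (nv * 5 + 33) + 20) + 4)
    (best_below ((nc + nc) ^ nc))"
proof -
  let ?N = "(nc + nc) ^ nc"
  let ?r = "If (Conj (Equal (Var vOk) (Const 1)) (Less (Var vTot) (Var vBest)))
      (vBest ::= Var vTot ;; vBestT ::= Var vT) Skip"
  let ?m = "m(vBest := (m vBest)(0 := big), vBestT := (m vBestT)(0 := 0))"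
  have "run (For vT (Var vPow) (evaluate g ;; ?r)) ?m (?N * (nc * (nv * 5 + 33) + 20) + 2) (best_below ?N)"
  proof (rule run_For[where N = ?N and T = "nc * (nv * 5 + 33) + 18" and J = best_below])
    show "expr_val ?m (Var vPow) = ?N" using tab by (simp add: tables_def)
    show "best_below 0 (?m(vT := (?m vT)(0 := 0)))" by (simp add: best_below_def)
    fix t m'
    assume t: "t < ?N" "m' vT 0 = t" and b: "best_below t m'"
      and f: "\<And>a. a \<notin> insert vT (writes (evaluate g ;; ?r)) \<Longrightarrow> m' a = ?m a"
    have tab': "tables m'" by (rule tables_frame[OF tab]) (auto simp: f)
    show "run (evaluate g ;; ?r) m' (nc * (nv * 5 + 33) + 18)
      (\<lambda>m''. best_below (Suc t) (m''(vT := (m'' vT)(0 := Suc t))))"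
    proof (rule run_Seq[where T' = 3, OF run_evaluate[OF tab' t(2,1) g]])
      fix m1 assume e: "word_read t m1 \<and> m1 vOk 0 = of_bool (valid t) \<and> m1 vSeg 0 = length (tours_of t) \<and>
          m1 vTot 0 = plan_cost (tours_of t) \<and>
          (\<forall>j < length (tours_of t). m1 aBase j = base (tours_of t ! j)) \<and>
          (valid t \<longrightarrow> (\<forall>j < length (tours_of t). \<forall>v \<in> set (tours_of t ! j). m1 9 v = j))"
        and f1: "\<And>a. a \<notin> writes (evaluate g) \<Longrightarrow> m1 a = m' a"
      have m1: "m1 vT 0 = t" "m1 vBest 0 = m' vBest 0" "m1 vBestT 0 = m' vBestT 0"
        using t(2) by (simp_all add: f1)
      have e: "m1 vOk 0 = of_bool (valid t)" "m1 vTot 0 = plan_cost (tours_of t)" using e by simp_all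
      show "run ?r m1 3 (\<lambda>m''. best_below (Suc t) (m''(vT := (m'' vT)(0 := Suc t))))"
      proof (cases "valid t \<and> plan_cost (tours_of t) < m' vBest 0")
        case True
        then have "score t = plan_cost (tours_of t)" by (simp add: score_def)
        then show ?thesis using True m1 e b
          by (auto simp: best_below_def less_Suc_eq intro: less_imp_le order_trans[OF less_imp_le])
      next
        case False
        \<comment> \<open>An invalid word scores \<open>big\<close>, which bounds
          \<open>vBest\<close> from above throughout.\<close>
        then have "m' vBest 0 \<le> score t" using b by (auto simp: score_def best_below_def)
        then show ?thesis using False m1 e b by (auto simp: best_below_def less_Suc_eq)
      qed
    qed simp
  qed simp_all
  moreover have "m vBig 0 = big" using tab by (simp add: tables_def ready_def)
  ultimately show ?thesis unfolding search_def by (simp add: run_weaken)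
qed

end

section \<open>Writing the routing\<close>

abbreviation (input) "vOut \<equiv> 49 :: nat"
abbreviation (input) "vCur \<equiv> 50 :: nat"
abbreviation (input) "vHop \<equiv> 51 :: nat"
abbreviation (input) "vTarget \<equiv> 52 :: nat"

text \<open>After j rounds \<open>nv - j\<close> edges remain, and that layer of the table holds
  \<open>hop (nv - j - 1)\<close>. A free step produces no output.\<close>

definition step_to :: prog where
  "step_to = vHop ::= Cell aHop (Plus (Cell aRow (Plus (Cell aRow (Minus nE (Var vJ))) (Var vCur))) (Var vTarget)) ;;
    If (Equal (Var vHop) (Var vCur)) Skip
      (Push 8 vOut (Var vHop) ;; Assign 7 (Var vSeg) (Plus (Cell 7 (Var vSeg)) (Const 1))) ;;
    vCur ::= Var vHop"

text \<open>The final assignment puts the machine at the target without an argument that the path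
  really ends there, so finiteness of the distance plays its part only in the mathematical lemmas on
  \<open>path\<close>.\<close>

definition walk_to :: prog where
  "walk_to = For vJ nE step_to ;; vCur ::= Var vTarget"

definition begin_tour :: prog where
  "begin_tour = If (Equal (Var vFresh) (Const 1))
    (vCur ::= Cell aBase (Var vSeg) ;; Assign 7 (Var vSeg) (Const 1) ;; Push 8 vOut (Var vCur) ;;
      vFresh ::= Const 0) Skip"

definition emit_letter :: prog where
  "emit_letter = begin_tour ;; vTarget ::= Cell aClient (Cell aWord (Var vI)) ;; walk_to ;;
    If (Less (Cell aWord (Var vI)) (Var vC)) Skip
      (vTarget ::= Cell aBase (Var vSeg) ;; walk_to ;; vSeg ::= Plus (Var vSeg) (Const 1) ;;
        vFresh ::= Const 1)"

definition emit :: prog where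
  "emit = vOut ::= Const 0 ;; vSeg ::= Const 0 ;; vFresh ::= Const 1 ;; For vI (Var vC) emit_letter"

lemma writes_step_to [simp]: "writes step_to = {vHop, 8, vOut, 7, vCur}"
  unfolding step_to_def by (rule equalityI) simp_all

lemma writes_walk_to [simp]: "writes walk_to = {vJ, vHop, 8, vOut, 7, vCur}"
  unfolding walk_to_def by (rule equalityI) simp_all

lemma writes_begin_tour [simp]: "writes begin_tour = {8, vOut, 7, vCur, vFresh}"
  unfolding begin_tour_def by (rule equalityI) simp_all

lemma writes_emit_letter [simp]:
  "writes emit_letter = {vJ, vHop, 8, vOut, 7, vCur, vFresh, vTarget, vSeg}"
  unfolding emit_letter_def by (rule equalityI) simp_all

lemma writes_emit [simp]:
  "writes emit = {vI, vJ, vHop, 8, vOut, 7, vCur, vFresh, vTarget, vSeg}"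
  unfolding emit_def by (rule equalityI) simp_all

section \<open>Correctness of the output phase\<close>

context vrp
begin

lemma route_snoc: "route u (s @ [v]) = route u s @ path nv (last (u # s)) v"
  by (induction s arbitrary: u) auto

lemma run_walk_to:
  assumes tab: "tables m" and u: "m vCur 0 = u" "u < nv" and v: "m vTarget 0 = v" "v < nv"
    and out: "holds m 8 vOut xs" and j: "m vSeg 0 = j" "m 7 j = l"
  shows "run walk_to m (nv * 8 + 3) (\<lambda>m'. m' vCur 0 = v \<and> holds m' 8 vOut (xs @ path nv u v) \<and>
    m' 7 = (m 7)(j := l + length (path nv u v)))"
proof -
  let ?J = "\<lambda>i m'. \<exists>ys x. x < nv \<and> m' vCur 0 = x \<and> holds m' 8 vOut (xs @ ys) \<and>
    m' 7 = (m 7)(j := l + length ys) \<and> path nv u v = ys @ path (nv - i) x v"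
  have "run (For vJ nE step_to) m (nv * 8 + 2) (?J nv)"
  proof (rule run_For[where N = nv and T = 6 and J = ?J])
    show "expr_val m nE = nv" using tab by (simp add: tables_def ready_def)
    show "?J 0 (m(vJ := (m vJ)(0 := 0)))"
      using u out j by (intro exI[of _ "[]"] exI[of _ u]) (simp add: holds_def fun_upd_idem)
    fix i m'
    assume i: "i < nv" and J: "?J i m'" and x: "m' vJ 0 = i"
      and f: "\<And>a. a \<notin> insert vJ (writes step_to) \<Longrightarrow> m' a = m a"
    obtain ys x where ys: "x < nv" "m' vCur 0 = x" "holds m' 8 vOut (xs @ ys)"
      "m' 7 = (m 7)(j := l + length ys)" "path nv u v = ys @ path (nv - i) x v"
      using J by blast
    define k where "k = nv - Suc i"
    have k: "nv - i = Suc k" "k < nv" using i by (simp_all add: k_def)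
    let ?h = "hop k x v"
    have h: "m aHop (m aRow (m aRow (Suc k) + x) + v) = ?h" "m 0 0 = nv"
      using tab k ys(1) v by (simp_all add: tables_def ready_def)
    have hn: "?h < nv" unfolding hop_def using nv_pos by (rule argmin_less)
    have p: "path (nv - i) x v = (if ?h = x then [] else [?h]) @ path (nv - Suc i) ?h v"
      using k k_def by simp
    show "run step_to m' 6 (\<lambda>m''. ?J (Suc i) (m''(vJ := (m'' vJ)(0 := Suc i))))"
    proof (cases "?h = x")
      case True
      then have "?J (Suc i) (m'(vHop := (m' vHop)(0 := x), vJ := (m' vJ)(0 := Suc i)))"
        using ys p by (intro exI[of _ ys] exI[of _ x]) (simp add: holds_def)
      then show ?thesis
        using True ys x h k v unfolding step_to_def by (simp add: f fun_upd_idem fun_upd_twist)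
    next
      case False
      have p': "path nv u v = (ys @ [?h]) @ path (nv - Suc i) ?h v" using p ys(5) False by simp
      let ?m = "m'(vHop := (m' vHop)(0 := ?h))"
      have "run (Push 8 vOut (Var vHop)) ?m 2 (\<lambda>m''. holds m'' 8 vOut ((xs @ ys) @ [?h]))"
        by (rule run_Push) (use ys in \<open>simp_all add: holds_def\<close>)
      then have "run (Push 8 vOut (Var vHop) ;; Assign 7 (Var vSeg) (Plus (Cell 7 (Var vSeg)) (Const 1)) ;;
        vCur ::= Var vHop) ?m 4 (\<lambda>m''. ?J (Suc i) (m''(vJ := (m'' vJ)(0 := Suc i))))"
      proof (rule run_Seq[where T' = 2])
        fix m1 assume 1: "holds m1 8 vOut ((xs @ ys) @ [?h])"
          and f1: "\<And>a. a \<notin> writes (Push 8 vOut (Var vHop)) \<Longrightarrow> m1 a = ?m a"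
        have "m1 vSeg 0 = j" "m1 7 = (m 7)(j := l + length ys)" "m1 vHop 0 = ?h"
          using j ys(4) by (simp_all add: f1 f)
        then show "run (Assign 7 (Var vSeg) (Plus (Cell 7 (Var vSeg)) (Const 1)) ;; vCur ::= Var vHop) m1 2
            (\<lambda>m''. ?J (Suc i) (m''(vJ := (m'' vJ)(0 := Suc i))))"
          using 1 hn p' by (simp add: holds_def)
      qed simp
      then show ?thesis
        using False ys(2) x h k v unfolding step_to_def by (simp add: f)
    qed
  qed simp_all
  then show ?thesis
    unfolding walk_to_def
  proof (rule run_Seq[where T' = 1])
    fix m1 assume "?J nv m1" and f: "\<And>a. a \<notin> writes (For vJ nE step_to) \<Longrightarrow> m1 a = m a"
    then show "run (vCur ::= Var vTarget) m1 1 (\<lambda>m'. m' vCur 0 = v \<and>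
        holds m' 8 vOut (xs @ path nv u v) \<and> m' 7 = (m 7)(j := l + length (path nv u v)))"
      using v by (auto simp: f holds_def)
  qed simp
qed

text \<open>The depots are given by tour number: a tour is written from its start on, when its last
  client and hence its \<open>base\<close> cannot yet be told from the letters read. The preceding
  evaluation has tabulated them.\<close>

definition emitted :: "(nat \<Rightarrow> nat) \<Rightarrow> nat list list \<Rightarrow> nat list" where
  "emitted b ss = concat (map (\<lambda>j. b j # route (b j) (ss ! j @ [b j])) [0..<length ss])"

definition between :: "(nat \<Rightarrow> nat) \<Rightarrow> nat list list \<Rightarrow> mem \<Rightarrow> bool" where
  "between b ss m \<longleftrightarrow> m vSeg 0 = length ss \<and> holds m 8 vOut (emitted b ss) \<and>
    (\<forall>j < length ss. m 7 j = Suc (length (route (b j) (ss ! j @ [b j]))))"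

text \<open>For empty \<open>s\<close> this is the state in which just the depot of the new tour has
  been written.\<close>

definition within :: "(nat \<Rightarrow> nat) \<Rightarrow> nat list list \<Rightarrow> nat list \<Rightarrow> mem \<Rightarrow> bool" where
  "within b ss s m \<longleftrightarrow> (let d = b (length ss) in
    m vSeg 0 = length ss \<and> m vCur 0 = last (d # s) \<and> m 7 (length ss) = Suc (length (route d s)) \<and>
    holds m 8 vOut (emitted b ss @ d # route d s) \<and>
    (\<forall>j < length ss. m 7 j = Suc (length (route (b j) (ss ! j @ [b j])))))"

definition emitting :: "(nat \<Rightarrow> nat) \<Rightarrow> nat list list \<Rightarrow> nat list \<Rightarrow> mem \<Rightarrow> bool" where
  "emitting b ss s m \<longleftrightarrow> m vFresh 0 = of_bool (s = []) \<and> (if s = [] then between b ss m else within b ss s m)"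

lemma emitting_vI [simp]: "emitting b ss s (m(vI := x)) \<longleftrightarrow> emitting b ss s m"
  by (simp add: emitting_def between_def within_def holds_def Let_def)

lemma emitted_snoc: "emitted b (ss @ [s]) = emitted b ss @ b (length ss) # route (b (length ss)) (s @ [b (length ss)])"
  by (simp add: emitted_def nth_append, intro arg_cong[where f = concat] map_cong) simp_all

lemma run_walk_to_within:
  assumes "tables m" "within b ss s m" "m vTarget 0 = v" "v < nv" "b (length ss) < nv" "\<And>v. v \<in> set s \<Longrightarrow> v < nv"
  shows "run walk_to m (nv * 8 + 3) (within b ss (s @ [v]))"
proof -
  let ?d = "b (length ss)"
  let ?u = "last (?d # s)"
  have u: "?u < nv" using assms(5,6) last_in_set[of "?d # s"] by auto
  show ?thesis
  proof (rule run_weaken[OF run_walk_to[of m ?u v "emitted b ss @ ?d # route ?d s" "length ss"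
        "Suc (length (route ?d s))"]])
    fix m'
    assume *: "m' vCur 0 = v \<and> holds m' 8 vOut ((emitted b ss @ ?d # route ?d s) @ path nv ?u v) \<and>
      m' 7 = (m 7)(length ss := Suc (length (route ?d s)) + length (path nv ?u v))"
      and f: "\<And>a. a \<notin> writes walk_to \<Longrightarrow> m' a = m a"
    show "within b ss (s @ [v]) m'"
      using * assms(2) unfolding within_def Let_def route_snoc by (simp add: f)
  qed (use assms u in \<open>simp_all add: within_def Let_def\<close>)
qed

text \<open>A letter causes at most two walks, one to its client and one back to the depot; hence
  \<open>nv * 16\<close>.\<close>

lemma run_emit_letter:
  assumes tab: "tables m" and e: "emitting b ss s m" and d: "m aWord (m vI 0) = d" "d < nc + nc"
    and b: "m aBase (length ss) = b (length ss)" "b (length ss) < nv" and s: "\<And>v. v \<in> set s \<Longrightarrow> v < nv"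
  shows "run emit_letter m (nv * 16 + 17) (\<lambda>m'. let (ss', s') = decode_letter (ss, s) d in emitting b ss' s' m')"
    (is "run _ _ _ ?Q")
proof -
  let ?b = "b (length ss)"
  let ?r2 = "walk_to ;; vSeg ::= Plus (Var vSeg) (Const 1) ;; vFresh ::= Const 1"
  let ?r1 = "If (Less (Cell aWord (Var vI)) (Var vC)) Skip (vTarget ::= Cell aBase (Var vSeg) ;; ?r2)"
  have c: "client d < nv" using d(2) by (rule client_less)
  have "run begin_tour m 6 (\<lambda>m'. within b ss s m' \<and> m' vFresh 0 = 0)"
  proof (cases "s = []")
    case True
    then show ?thesis
      using e b unfolding begin_tour_def
      by (simp add: emitting_def between_def within_def Let_def Push_def holds_def nth_append less_Suc_eq)
  next
    case False
    then show ?thesis using e unfolding begin_tour_def by (simp add: emitting_def)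
  qed
  then show ?thesis
    unfolding emit_letter_def
  proof (rule run_Seq[where T' = "nv * 16 + 11"])
    fix m1 assume 1: "within b ss s m1 \<and> m1 vFresh 0 = 0" and f1: "\<And>a. a \<notin> writes begin_tour \<Longrightarrow> m1 a = m a"
    let ?m1 = "m1(vTarget := (m1 vTarget)(0 := client d))"
    have t1: "tables ?m1" by (rule tables_frame[OF tab]) (auto simp: f1)
    have w1: "within b ss s ?m1" using 1 by (simp add: within_def Let_def holds_def)
    have "run (walk_to ;; ?r1) ?m1 (nv * 16 + 10) ?Q"
    proof (rule run_Seq[where T' = "nv * 8 + 7", OF run_walk_to_within[OF t1 w1 _ c b(2) s]])
      fix m2 assume 2: "within b ss (s @ [client d]) m2" and f2: "\<And>a. a \<notin> writes walk_to \<Longrightarrow> m2 a = ?m1 a"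
      have m2: "m2 aWord (m2 vI 0) = d" "m2 vC 0 = nc" "m2 vFresh 0 = 0" "m2 aBase (length ss) = ?b" "m2 vSeg 0 = length ss"
        using d 1 2 tab b by (simp_all add: f2 f1 tables_def within_def Let_def)
      show "run ?r1 m2 (nv * 8 + 7) ?Q"
      proof (cases "d < nc")
        case True
        then show ?thesis using m2 2 by (simp add: decode_letter_def emitting_def)
      next
        case False
        let ?m2 = "m2(vTarget := (m2 vTarget)(0 := ?b))"
        have t2: "tables ?m2" by (rule tables_frame[OF tab]) (auto simp: f1 f2)
        have w2: "within b ss (s @ [client d]) ?m2" using 2 by (simp add: within_def Let_def holds_def)
        have "run ?r2 ?m2 (nv * 8 + 5) ?Q"
        proof (rule run_Seq[where T' = 2, OF run_walk_to_within[OF t2 w2 _ b(2) b(2)]])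
          show "v < nv" if "v \<in> set (s @ [client d])" for v using that s c by auto
          fix m3 assume 3: "within b ss ((s @ [client d]) @ [?b]) m3"
          have "between b (ss @ [s @ [client d]]) (m3(vSeg := (m3 vSeg)(0 := Suc (length ss)), vFresh := (m3 vFresh)(0 := 1)))"
            using 3 by (simp add: between_def within_def Let_def emitted_snoc holds_def nth_append less_Suc_eq)
          moreover have "m3 vSeg 0 = length ss" using 3 by (simp add: within_def Let_def)
          ultimately show "run (vSeg ::= Plus (Var vSeg) (Const 1) ;; vFresh ::= Const 1) m3 2 ?Q"
            using False by (simp add: decode_letter_def emitting_def)
        qed simp_all
        from run_weaken[OF this] show ?thesis using False m2 by simp
      qed
    qed simp_all
    moreover have "m1 aClient (m1 aWord (m1 vI 0)) = client d" using tab d by (simp add: f1 tables_def)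
    ultimately show "run (vTarget ::= Cell aClient (Cell aWord (Var vI)) ;; walk_to ;; ?r1) m1 (nv * 16 + 11) ?Q"
      using run_weaken by simp
  qed simp
qed

lemma run_emit:
  assumes tab: "tables m" and w: "word_read t m" and v: "valid t"
    and b: "\<And>j. j < length (tours_of t) \<Longrightarrow> m aBase j = base (tours_of t ! j)"
  shows "run emit m (nc * (nv * 16 + 19) + 5) (\<lambda>m'. m' vSeg 0 = length (tours_of t) \<and>
    holds m' 8 vOut (concat (map tour (tours_of t))) \<and>
    (\<forall>j < length (tours_of t). m' 7 j = length (tour (tours_of t ! j))))" (is "run _ _ _ ?Q")
proof -
  let ?d = "\<lambda>i. decode (take i (word t))"
  define bs where "bs j = base (tours_of t ! j)" for j
  let ?J = "\<lambda>i. emitting bs (fst (?d i)) (snd (?d i))"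
  let ?m = "m(vOut := (m vOut)(0 := 0), vSeg := (m vSeg)(0 := 0), vFresh := (m vFresh)(0 := 1))"
  have tk: "take nc (word t) = word t" by simp
  \<comment> \<open>The depot of the tour being written must have been tabulated. The number of
    tours begun, completed or open, never decreases; letter \<open>i\<close> belongs to one more
    than those completed before it, and for a valid word all are completed at the end.\<close>
  have len: "length (fst (?d i)) < length (tours_of t)" if "i < nc" for i
  proof -
    have "length (fst (?d k)) + of_bool (snd (?d k) \<noteq> []) \<le> length (fst (?d (k + n))) + of_bool (snd (?d (k + n)) \<noteq> [])"
      if "k + n \<le> nc" for k n
      using that
    proof (induction n)
      case (Suc n)
      let ?x = "?d (k + n)" and ?y = "?d (k + Suc n)"
      have "?y = decode_letter ?x (word t ! (k + n))" using Suc.prems decode_take[of "k + n" t] by simp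
      then have "length (fst ?x) + of_bool (snd ?x \<noteq> []) \<le> length (fst ?y) + of_bool (snd ?y \<noteq> [])"
        by (simp add: decode_letter_def of_bool_def)
      moreover have "length (fst (?d k)) + of_bool (snd (?d k) \<noteq> []) \<le>
          length (fst ?x) + of_bool (snd ?x \<noteq> [])"
        using Suc by simp
      ultimately show ?case by (rule order_trans[rotated])
    qed simp
    from this[of "Suc i" "nc - Suc i"] that decode_take[OF that, of t] v
    show ?thesis unfolding valid_def tours_of_def by (auto simp: decode_letter_def split: if_splits)
  qed
  have "run (For vI (Var vC) emit_letter) ?m (nc * (nv * 16 + 19) + 2) ?Q"
  proof (rule run_For[where N = nc and T = "nv * 16 + 17" and J = ?J])
    show "expr_val ?m (Var vC) = nc" using tab by (simp add: tables_def)
    show "?J 0 (?m(vI := (?m vI)(0 := 0)))" by (simp add: emitting_def between_def emitted_def holds_def)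
    fix i m'
    assume i: "i < nc" and J: "?J i m'" and x: "m' vI 0 = i"
      and f: "\<And>a. a \<notin> insert vI (writes emit_letter) \<Longrightarrow> m' a = ?m a"
    have t: "tables m'" by (rule tables_frame[OF tab]) (auto simp: f)
    have d: "m' aWord (m' vI 0) = word t ! i" using w i x by (simp add: f word_read_def)
    have s: "v < nv" if "v \<in> set (snd (?d i))" for v
    proof -
      have "v \<in> set (map client (take i (word t)))"
        unfolding concat_decode[symmetric] using that by simp
      then obtain e where "e \<in> set (word t)" "v = client e" by (auto dest: in_set_takeD)
      then show ?thesis using client_less word_less by simp
    qed
    have b': "m' aBase (length (fst (?d i))) = bs (length (fst (?d i)))" "bs (length (fst (?d i))) < nv"
      using b len[OF i] argmin_less[OF nv_pos] by (simp_all add: f bs_def base_def depot_def)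
    show "run emit_letter m' (nv * 16 + 17) (\<lambda>m''. ?J (Suc i) (m''(vI := (m'' vI)(0 := Suc i))))"
    proof (rule run_weaken[OF run_emit_letter[OF t J d word_nth_less[OF i] b' s]])
      fix m'' assume "let (ss', s') = decode_letter (fst (?d i), snd (?d i)) (word t ! i) in emitting bs ss' s' m''"
      then show "?J (Suc i) (m''(vI := (m'' vI)(0 := Suc i)))"
        using decode_take[OF i, of t] by (simp add: split_beta Let_def)
    qed simp_all
  next
    fix m' assume "?J nc m'"
    moreover have "emitted bs (tours_of t) = concat (map tour (tours_of t))"
      unfolding emitted_def bs_def
      by (intro arg_cong[where f = concat] nth_equalityI) (simp_all add: tour_def)
    ultimately show "?Q m'"
      using v unfolding valid_def tours_of_def[symmetric] tk
      by (simp add: emitting_def between_def bs_def tour_def)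
  qed simp_all
  from run_weaken[OF this] show ?thesis unfolding emit_def by simp
qed

end

section \<open>The algorithm\<close>

text \<open>Array 6 is untouched until a routing has been written, so its initial 0 already reports
  that there is none.\<close>

definition solver :: "nat \<Rightarrow> prog" where
  "solver g = setup_tables ;; search g ;; If (Less (Var vBest) (Var vBig))
    (vT ::= Var vBestT ;; evaluate g ;; emit ;; Assign 6 (Const 0) (Const 1) ;; Assign 6 (Const 1) (Var vSeg))
    Skip"

text \<open>From c = 2 on, \<open>c + c \<le> c ^ 2\<close>. The factor 2 pays for c = 1, and c = 0
  relies on \<open>0 ^ 0 = 1\<close>.\<close>

lemma double_power_le: "(c + c) ^ c \<le> 2 * c ^ (2 * c)" for c :: nat
proof (cases "c \<le> 1")
  case True
  then consider "c = 0" | "c = 1" by linarith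
  then show ?thesis by cases simp_all
next
  case False
  then have "c + c \<le> c ^ 2" by (simp add: power2_eq_square flip: mult_2)
  then have "(c + c) ^ c \<le> (c ^ 2) ^ c" by (rule power_mono) simp
  then show ?thesis by (simp add: power_mult)
qed

section \<open>Correctness and running time of the whole algorithm\<close>

context vrp
begin

definition solved :: "mem \<Rightarrow> bool" where
  "solved m \<longleftrightarrow> (if \<exists>R A. routing I R A
    then \<exists>R A. outputs_routing I m R A \<and> optimal_routing I R A else outputs_none m)"

lemma run_output:
  assumes tab: "tables m" and b: "best_below ((nc + nc) ^ nc) m" "m vBest 0 < big" and g: "gas_flag g"
  shows "run (vT ::= Var vBestT ;; evaluate g ;; emit ;; Assign 6 (Const 0) (Const 1) ;;
    Assign 6 (Const 1) (Var vSeg)) m (nc * (nv * 21 + 52) + 23) solved"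
proof -
  define t where "t = m vBestT 0"
  have t: "t < (nc + nc) ^ nc" "score t < big" "\<And>t'. t' < (nc + nc) ^ nc \<Longrightarrow> score t \<le> score t'"
    using b by (simp_all add: best_below_def t_def)
  have v: "valid t" using t(2) by (simp add: score_def split: if_splits)
  let ?m = "m(vT := (m vT)(0 := t))"
  let ?o = "Assign 6 (Const 0) (Const 1) ;; Assign 6 (Const 1) (Var vSeg)"
  have tab': "tables ?m" by (rule tables_frame[OF tab]) auto
  have "run (evaluate g ;; emit ;; ?o) ?m (nc * (nv * 21 + 52) + 22) solved"
  proof (rule run_Seq[where T' = "nc * (nv * 16 + 19) + 7", OF run_evaluate[OF tab' _ t(1) g]])
    fix m1
    assume e: "word_read t m1 \<and> m1 vOk 0 = of_bool (valid t) \<and> m1 vSeg 0 = length (tours_of t) \<and>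
        m1 vTot 0 = plan_cost (tours_of t) \<and>
        (\<forall>j < length (tours_of t). m1 aBase j = base (tours_of t ! j)) \<and>
        (valid t \<longrightarrow> (\<forall>j < length (tours_of t). \<forall>v \<in> set (tours_of t ! j). m1 9 v = j))"
      and f1: "\<And>a. a \<notin> writes (evaluate g) \<Longrightarrow> m1 a = ?m a"
    have tab1: "tables m1" by (rule tables_frame[OF tab']) (auto simp: f1)
    have w: "word_read t m1" and bs: "\<And>j. j < length (tours_of t) \<Longrightarrow> m1 aBase j = base (tours_of t ! j)"
      and A: "\<And>j v. j < length (tours_of t) \<Longrightarrow> v \<in> set (tours_of t ! j) \<Longrightarrow> m1 9 v = j"
      using e v by simp_all
    show "run (emit ;; ?o) m1 (nc * (nv * 16 + 19) + 7) solved"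
    proof (rule run_Seq[where T' = 2, OF run_emit[OF tab1 w v bs]])
      fix m2
      assume o: "m2 vSeg 0 = length (tours_of t) \<and> holds m2 8 vOut (concat (map tour (tours_of t))) \<and>
          (\<forall>j < length (tours_of t). m2 7 j = length (tour (tours_of t ! j)))"
        and f2: "\<And>a. a \<notin> writes emit \<Longrightarrow> m2 a = m1 a"
      let ?m2 = "m2(6 := (m2 6)(0 := 1, 1 := length (tours_of t)))"
      let ?R = "map tour (tours_of t)"
      have opt: "optimal_routing I ?R (m1 9)" using optimal_routing_tours[OF t(2,3) A] .
      moreover have "outputs_routing I ?m2 ?R (m1 9)"
      proof -
        have "map (?m2 7) [0..<length ?R] = map length ?R"
          by (rule nth_equalityI) (use o in simp_all)
        moreover have "map (?m2 8) [0..<length (concat ?R)] = concat ?R"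
          by (rule nth_equalityI) (use o in \<open>simp_all add: holds_def\<close>)
        ultimately show ?thesis unfolding outputs_routing_def by (simp add: f2)
      qed
      moreover have "routing I ?R (m1 9)" using opt by (simp add: optimal_routing_def)
      ultimately have "solved ?m2" unfolding solved_def by auto
      then show "run ?o m2 2 solved" using o by simp
    qed simp_all
  qed (simp_all add: algebra_simps)
  from run_weaken[OF this] show ?thesis by (simp add: t_def)
qed

definition solver_time :: nat where
  "solver_time = setup_time + (((nc + nc) ^ nc * (nc * (nv * 5 + 33) + 20) + 4) +
    (nc * (nv * 21 + 52) + 24))"

lemma run_solver:
  assumes g: "gas_flag g"
  shows "run (solver g) (input_mem I) solver_time solved"
  unfolding solver_def solver_time_def
proof (rule run_Seq[OF run_setup_tables])
  show "input (input_mem I)" by (simp add: input_def)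
  fix m1 assume t1: "tables m1" and f1: "\<And>a. a \<notin> writes setup_tables \<Longrightarrow> m1 a = input_mem I a"
  let ?o = "vT ::= Var vBestT ;; evaluate g ;; emit ;; Assign 6 (Const 0) (Const 1) ;; Assign 6 (Const 1) (Var vSeg)"
  let ?i = "If (Less (Var vBest) (Var vBig)) ?o Skip"
  show "run (search g ;; ?i) m1 (((nc + nc) ^ nc * (nc * (nv * 5 + 33) + 20) + 4) +
    (nc * (nv * 21 + 52) + 24)) solved"
  proof (rule run_Seq[OF run_search[OF t1 g]])
    fix m2 assume b: "best_below ((nc + nc) ^ nc) m2" and f2: "\<And>a. a \<notin> writes (search g) \<Longrightarrow> m2 a = m1 a"
    have t2: "tables m2" by (rule tables_frame[OF t1]) (auto simp: f2)
    have big: "m2 vBig 0 = big" using t2 by (simp add: tables_def ready_def)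
    show "run ?i m2 (nc * (nv * 21 + 52) + 24) solved"
    proof (cases "m2 vBest 0 < big")
      case True
      have "run ?o m2 (nc * (nv * 21 + 52) + 24 - 1) solved"
        by (rule run_weaken[OF run_output[OF t2 b True g]]) simp_all
      then show ?thesis using True big unfolding run_If by simp
    next
      case False
      have "\<not> routing I R A" for R A
      proof (rule no_routing)
        fix t assume "t < (nc + nc) ^ nc"
        then show "big \<le> score t" using b False by (auto simp: best_below_def)
      qed
      moreover have "m2 6 0 = 0"
        by (simp add: f2 f1 setup_tables_def input_mem_def Let_def)
      ultimately have "solved m2" by (simp add: solved_def outputs_none_def)
      then show ?thesis using False big by simp
    qed
  qed simp
qed simp

text \<open>All polynomial terms are at most multiples of \<open>nv ^ 4\<close>, using
  \<open>nc \<le> nv\<close>, and all numbers of words multiples of \<open>nc ^ (2 * nc)\<close>.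
  The total is 273 + 20 + 144 = 437 times their product, rounded up to 500.\<close>

lemma solver_time_le: "solver_time \<le> 500 * nc ^ (2 * nc) * nv ^ 4"
proof -
  define X where "X = nv ^ 4"
  define P where "P = nc ^ (2 * nc)"
  define N where "N = (nc + nc) ^ nc"
  have c: "nc \<le> nv" using length_clist_le by (simp add: nc_def)
  have pw: "nv ^ k \<le> X" if "k \<le> 4" for k
    unfolding X_def using nv_pos that by (intro power_increasing) auto
  have n: "1 \<le> X" "nv \<le> X" "nv * nv \<le> X" "nv * (nv * nv) \<le> X" "nv * (nv * (nv * nv)) \<le> X"
    using pw[of 0] pw[of 1] pw[of 2] pw[of 3] pw[of 4] by (simp_all add: numeral_eq_Suc)
  have P: "1 \<le> P" by (cases "nc = 0") (simp_all add: P_def)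
  have N: "N \<le> 2 * P" unfolding N_def P_def by (rule double_power_le)
  \<comment> \<open>The distance table dictates the exponent 4: about \<open>nv ^ 3\<close> entries,
    each a minimum over \<open>nv\<close> vertices.\<close>
  have L: "(nv * nv + nv * (nv * nv)) * (nv * 5 + 10) \<le> 30 * X"
  proof -
    have "(nv * nv + nv * (nv * nv)) * (nv * 5 + 10) =
      5 * (nv * (nv * (nv * nv))) + 15 * (nv * (nv * nv)) + 10 * (nv * nv)"
      by (simp add: algebra_simps)
    then show ?thesis using n by linarith
  qed
  have cn: "nc * (nv * k + l) \<le> (k + l) * X" for k l
  proof -
    have "nc * (nv * k + l) \<le> nv * (nv * k + l)" using c by (rule mult_right_mono) simp
    also have "\<dots> = k * (nv * nv) + l * nv" by (simp add: algebra_simps)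
    also have "\<dots> \<le> k * X + l * X" using n by (intro add_mono mult_left_mono) simp_all
    finally show ?thesis by (simp add: algebra_simps)
  qed
  have cc: "nc * ((nc + nc) * 3 + 6) \<le> 12 * X"
  proof -
    have "nc * ((nc + nc) * 3 + 6) \<le> nc * (nv * 6 + 6)" using c by (intro mult_left_mono) simp_all
    also have "\<dots> \<le> (6 + 6) * X" by (rule cn)
    finally show ?thesis by (simp only: numeral_plus_numeral semiring_norm)
  qed
  have "setup_time \<le> 200 * X + 20 * P"
  proof -
    \<comment> \<open>The products are replaced by arbitrary numbers, so that the estimate becomes
      linear.\<close>
    have "(a * 6 + 6) + ((b + c) * 14 + 6) + (b * 6 + 6) + (b * 5 + 2) +
      (a * 4 + 2) + (y + 2) + (a * 10 + 6) + (z + 3) + (N * 10 + 4) \<le> 200 * X + 20 * P"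
      if "a \<le> X" "b \<le> X" "c \<le> X" "y \<le> 30 * X" "z \<le> 12 * X" for a b c y z :: nat
    proof -
      have "(a * 6 + 6) + ((b + c) * 14 + 6) + (b * 6 + 6) + (b * 5 + 2) + (a * 4 + 2) + (y + 2) +
        (a * 10 + 6) + (z + 3) + (N * 10 + 4) = 37 * 1 + a * 20 + b * 25 + c * 14 + y + z + N * 10"
        by simp
      also have "\<dots> \<le> 37 * X + X * 20 + X * 25 + X * 14 + 30 * X + 12 * X + (2 * P) * 10"
        by (intro add_mono mult_left_mono mult_right_mono n(1) N that) simp_all
      finally show ?thesis by simp
    qed
    from this[OF n(2-4) L cc] show ?thesis unfolding setup_time_def N_def[symmetric] .
  qed
  moreover have "N * (nc * (nv * 5 + 33) + 20) \<le> 116 * (P * X)"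
  proof -
    have "N * (nc * (nv * 5 + 33) + 20) \<le> (2 * P) * (58 * X)"
      using cn[of 5 33] n by (intro mult_mono N) simp_all
    then show ?thesis by simp
  qed
  moreover have "nc * (nv * 21 + 52) \<le> 73 * X" using cn[of 21 52] by simp
  moreover have "X \<le> P * X" "P \<le> P * X" "1 \<le> P * X" using P n(1) by simp_all
  moreover have "s + ((y + 4) + (z + 24)) \<le> 500 * (P * X)"
    if "s \<le> 200 * X + 20 * P" "y \<le> 116 * (P * X)" "z \<le> 73 * X"
      "X \<le> P * X" "P \<le> P * X" "1 \<le> P * X" for s y z
  proof -
    have "s + ((y + 4) + (z + 24)) = s + y + z + 28 * 1" by simp
    also have "\<dots> \<le> (200 * X + 20 * P) + 116 * (P * X) + 73 * X + 28 * (P * X)"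
      by (intro add_mono mult_left_mono that) simp_all
    also have "\<dots> = 273 * X + 20 * P + 144 * (P * X)" by simp
    also have "\<dots> \<le> 273 * (P * X) + 20 * (P * X) + 144 * (P * X)"
      by (intro add_mono mult_left_mono that order_refl) simp_all
    finally show ?thesis by simp
  qed
  ultimately have "solver_time \<le> 500 * (P * X)"
    unfolding solver_time_def N_def[symmetric] by blast
  then show ?thesis by (simp add: P_def X_def)
qed

end

theorem theorem4p1:
  fixes P :: "nat cvrp set"
  assumes "P \<in> {LoadCVRP, GasCVRP, LoadGasCVRP}"
  shows "\<exists>(p :: prog) (a :: nat) (b :: nat) (d :: nat).
           solves_within p P (\<lambda>c n. a * c ^ (b * c) * n ^ d)"
proof -
  \<comment> \<open>The program may depend on the problem but not on the instance; among the three
    problems only \<open>LoadCVRP\<close> has no gas limit.\<close>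
  define g :: nat where "g = of_bool (P \<noteq> LoadCVRP)"
  have "solves_within (solver g) P (\<lambda>c n. 500 * c ^ (2 * c) * n ^ 4)"
    unfolding solves_within_def
  proof (intro ballI impI)
    fix I assume I: "I \<in> P" and v: "verts I = {..<card (verts I)}"
    have "cvrp_instance I"
      using assms I by (auto simp: LoadCVRP_def GasCVRP_def LoadGasCVRP_def)
    then interpret vrp I using v by unfold_locales
    have "gas_flag g"
    proof (cases "P = LoadCVRP")
      case True
      then show ?thesis using I by (simp add: g_def gas_flag_def LoadCVRP_def)
    next
      case False
      then have "gas I \<noteq> None" using assms I by (auto simp: GasCVRP_def LoadGasCVRP_def)
      then show ?thesis using False by (auto simp: g_def gas_flag_def input_mem_def Let_def)
    qed
    then have "run (solver g) (input_mem I) solver_time solved" by (rule run_solver)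
    then obtain t m where "exec (solver g) (input_mem I) t m" "t \<le> solver_time" "solved m"
      unfolding run_def by blast
    moreover have "solver_time \<le> 500 * card (clients I) ^ (2 * card (clients I)) * card (verts I) ^ 4"
      using solver_time_le by (simp add: nc_def length_clist nv_def)
    ultimately show "\<exists>t m. exec (solver g) (input_mem I) t m \<and>
        t \<le> 500 * card (clients I) ^ (2 * card (clients I)) * card (verts I) ^ 4 \<and>
        (if \<exists>R A. routing I R A then \<exists>R A. outputs_routing I m R A \<and> optimal_routing I R A
         else outputs_none m)"
      unfolding solved_def by (meson le_trans)
  qed
  then show ?thesis by blast
qed

end
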